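(* Let $\mathcal D$ be a directed acyclic graph with finite vertex set $V$. If $\mathcal D$ is not transitive, then there exist finite-dimensional complex Hilbert spaces $\mathcal H_v$ ($v\in V$) and an order-invariant family $\mathcal Q=\{Q_{v|\operatorname{pa}(v)}:v\in V\}$ of positive definite quantum kernels for $\mathcal D$ on these spaces whose common state $\Phi_{\mathcal D}(\mathcal Q)$ is not directed quantum Markov with respect to $\mathcal D$.
   Context: For finite-dimensional complex Hilbert spaces $\mathcal H_v$, $v\in V$, put $\mathcal H_A=\bigotimes_{v\in A}\mathcal H_v$ for $A\subseteq V$, with $\mathcal H_\varnothing=\mathbb C$. An operator on $\mathcal H_A$ used on a larger tensor product is understood to be tensored with the identity on the complementary factors. For positive definite $M,N$ on the same space, $M\star N:=N^{1/2}MN^{1/2}$. For a vertex $v$ of $\mathcal D$, $\operatorname{pa}(v)$ is its set of parents. $\mathcal D$ is transitive if whenever there is a directed path from $i$ to $k$ there is also an edge $i\to k$. A total ordering $<$ of $V$ is topological if $u<w$ for every arrow $u\to w$; $\operatorname{pr}(v)=\{u\in V:u<v\}$. A family of quantum kernels for $\mathcal D$ assigns to every $v\in V$ a positive definite operator $Q_{v|\operatorname{pa}(v)}$ on $\mathcal H_{\{v\}\cup\operatorname{pa}(v)}$ with $\operatorname{Tr}_v(Q_{v|\operatorname{pa}(v)})=I_{\operatorname{pa}(v)}$ (for a root $v$, this is a positive definite density operator $Q_v$ on $\mathcal H_v$). For a topological ordering $v_1<\cdots<v_n$ put $V_j=\{v_1,\dots,v_j\}$, $\omega_{V_1}=Q_{v_1}$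 and $\omega_{V_j}=Q_{v_j|\operatorname{pa}(v_j)}\star\omega_{V_{j-1}}$ for $j=2,\dots,n$ (with both factors embedded into operators on $\mathcal H_{V_j}$); the ordered kernel construction is $\Phi_{\mathcal D,<}(\mathcal Q):=\omega_{V_n}$, a positive definite density operator on $\mathcal H_V$. The family $\mathcal Q$ is order-invariant if $\Phi_{\mathcal D,<}(\mathcal Q)$ is the same state for every topological ordering $<$ of $\mathcal D$; this common state is denoted $\Phi_{\mathcal D}(\mathcal Q)$. For a positive definite density operator $\rho$ on $\mathcal H_V$, $\rho_A=\operatorname{Tr}_{V\setminus A}(\rho)$, $\operatorname S(A)_\rho=-\operatorname{Tr}(\rho_A\log\rho_A)$, $\operatorname S(\varnothing)_\rho=0$. For pairwise disjoint $A,B,C\subseteq V$, $I(A:B\mid C)_\rho=\operatorname S(A\cup C)_\rho+\operatorname S(B\cup C)_\rho-\operatorname S(C)_\rho-\operatorname S(A\cup B\cup C)_\rho$, and $A\perp\!\!\!\perp_Q B\mid C$ means $I(A:B\mid C)_\rho=0$. A state $\rho$ is directed quantum Markov with respect to $\mathcal D$ if $v\perp\!\!\!\perp_Q(\operatorname{pr}(v)\setminus\operatorname{pa}(v))\mid\operatorname{pa}(v)$ for all $v\in V$, for one (equivalently, every) topological ordering of $\mathcal D$; equivalently, it satisfies the local directed Markov property $v\perp\!\!\!\perp_Q(\operatorname{nd}(v)\setminus\operatorname{pa}(v))\mid\operatorname{pa}(v)$ for all $v\in V$, where $\operatorname{nd}(v)$ is the set of vertices other than $v$ that are not descendants of $v$.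 *)

theory Defs
  imports Complex_Main "HOL-Library.FuncSet"
begin

section \<open>Operators on finite-dimensional Hilbert spaces\<close>

text \<open>
  For a finite set \<open>I\<close>, operators on the Hilbert space \<open>\<complex>\<^sup>I\<close> are represented by their matrices
  with respect to the standard orthonormal basis, extended by zero outside \<open>I \<times> I\<close> so that equality
  of operators is equality of functions.
\<close>

type_synonym 'i cmatrix = "'i \<Rightarrow> 'i \<Rightarrow> complex"

definition operators :: "'i set \<Rightarrow> 'i cmatrix set" where
  "operators I = {M. \<forall>x y. x \<notin> I \<or> y \<notin> I \<longrightarrow> M x y = 0}"

definition op_id :: "'i set \<Rightarrow> 'i cmatrix" where
  "op_id I = (\<lambda>x y. if x \<in> I \<and> x = y then 1 else 0)"

definition op_mult :: "'i set \<Rightarrow> 'i cmatrix \<Rightarrow> 'i cmatrix \<Rightarrow> 'i cmatrix" where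
  "op_mult I M N = (\<lambda>x y. \<Sum>z\<in>I. M x z * N z y)"

definition op_apply :: "'i set \<Rightarrow> 'i cmatrix \<Rightarrow> ('i \<Rightarrow> complex) \<Rightarrow> 'i \<Rightarrow> complex" where
  "op_apply I M \<psi> = (\<lambda>x. \<Sum>y\<in>I. M x y * \<psi> y)"

definition op_trace :: "'i set \<Rightarrow> 'i cmatrix \<Rightarrow> complex" where
  "op_trace I M = (\<Sum>x\<in>I. M x x)"

definition positive_definite :: "'i set \<Rightarrow> 'i cmatrix \<Rightarrow> bool" where
  "positive_definite I M \<longleftrightarrow> M \<in> operators I \<and> (\<forall>x\<in>I. \<forall>y\<in>I. M x y = cnj (M y x)) \<and>
     (\<forall>\<psi>. (\<exists>x\<in>I. \<psi> x \<noteq> 0) \<longrightarrow> 0 < Re (\<Sum>x\<in>I. cnj (\<psi> x) * op_apply I M \<psi> x))"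

text \<open>
  Functional calculus: \<open>f(M)\<close> is the operator acting as the scalar \<open>f c\<close> on the eigenspace of \<open>M\<close>
  for each eigenvalue \<open>c\<close>. It exists and is unique for Hermitian \<open>M\<close>, because then the eigenvalues
  are real and \<open>\<complex>\<^sup>I\<close> is the orthogonal sum of the eigenspaces.
\<close>

definition op_fun :: "'i set \<Rightarrow> (real \<Rightarrow> real) \<Rightarrow> 'i cmatrix \<Rightarrow> 'i cmatrix" where
  "op_fun I f M = (THE F. F \<in> operators I \<and>
     (\<forall>c \<psi>. (\<forall>x\<in>I. op_apply I M \<psi> x = complex_of_real c * \<psi> x) \<longrightarrow>
            (\<forall>x\<in>I. op_apply I F \<psi> x = complex_of_real (f c) * \<psi> x)))"

text \<open>The product \<open>M \<star> N = N\<^bsup>1/2\<^esup> M N\<^bsup>1/2\<^esup>\<close>.\<close>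

definition op_star :: "'i set \<Rightarrow> 'i cmatrix \<Rightarrow> 'i cmatrix \<Rightarrow> 'i cmatrix" where
  "op_star I M N = op_mult I (op_mult I (op_fun I sqrt N) M) (op_fun I sqrt N)"

section \<open>Tensor products\<close>

text \<open>
  The Hilbert space at \<open>v\<close> is \<open>\<complex>\<close> to the power \<open>d v\<close>. The product basis of the tensor product over
  \<open>v \<in> A\<close> is indexed by the multi-indices in \<open>idx d A\<close>; for \<open>A = {}\<close> there is exactly one, so the
  empty tensor product is \<open>\<complex>\<close>.
\<close>

definition idx :: "('v \<Rightarrow> nat) \<Rightarrow> 'v set \<Rightarrow> ('v \<Rightarrow> nat) set" where
  "idx d A = (\<Pi>\<^sub>E v\<in>A. {..<d v})"

text \<open>For \<open>A \<subseteq> B\<close>: the operator \<open>M\<close> on the factors in \<open>A\<close>, tensored with the identity on \<open>B - A\<close>.\<close>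

definition embed :: "('v \<Rightarrow> nat) \<Rightarrow> 'v set \<Rightarrow> 'v set \<Rightarrow> ('v \<Rightarrow> nat) cmatrix \<Rightarrow> ('v \<Rightarrow> nat) cmatrix" where
  "embed d A B M = (\<lambda>x y.
     if x \<in> idx d B \<and> y \<in> idx d B \<and> (\<forall>v\<in>B - A. x v = y v)
     then M (restrict x A) (restrict y A) else 0)"

text \<open>For \<open>A \<subseteq> B\<close>: the partial trace of an operator on the factors in \<open>B\<close> over those in \<open>B - A\<close>.\<close>

definition partial_trace ::
  "('v \<Rightarrow> nat) \<Rightarrow> 'v set \<Rightarrow> 'v set \<Rightarrow> ('v \<Rightarrow> nat) cmatrix \<Rightarrow> ('v \<Rightarrow> nat) cmatrix" where
  "partial_trace d B A M = (\<lambda>x y.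
     if x \<in> idx d A \<and> y \<in> idx d A
     then \<Sum>z\<in>idx d (B - A). M (override_on x z (B - A)) (override_on y z (B - A)) else 0)"

section \<open>Entropy and conditional independence\<close>

definition entropy ::
  "('v \<Rightarrow> nat) \<Rightarrow> 'v set \<Rightarrow> ('v \<Rightarrow> nat) cmatrix \<Rightarrow> 'v set \<Rightarrow> real" where
  "entropy d V \<rho> A = (if A = {} then 0 else
     let \<rho>\<^sub>A = partial_trace d V A \<rho>
     in - Re (op_trace (idx d A) (op_mult (idx d A) \<rho>\<^sub>A (op_fun (idx d A) ln \<rho>\<^sub>A))))"

definition cond_mutual_info ::
  "('v \<Rightarrow> nat) \<Rightarrow> 'v set \<Rightarrow> ('v \<Rightarrow> nat) cmatrix \<Rightarrow> 'v set \<Rightarrow> 'v set \<Rightarrow> 'v set \<Rightarrow> real" where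
  "cond_mutual_info d V \<rho> A B C =
     entropy d V \<rho> (A \<union> C) + entropy d V \<rho> (B \<union> C) - entropy d V \<rho> C - entropy d V \<rho> (A \<union> B \<union> C)"

definition cond_indep ::
  "('v \<Rightarrow> nat) \<Rightarrow> 'v set \<Rightarrow> ('v \<Rightarrow> nat) cmatrix \<Rightarrow> 'v set \<Rightarrow> 'v set \<Rightarrow> 'v set \<Rightarrow> bool" where
  "cond_indep d V \<rho> A B C \<longleftrightarrow> cond_mutual_info d V \<rho> A B C = 0"

section \<open>Directed acyclic graphs\<close>

definition dag :: "'v set \<Rightarrow> ('v \<times> 'v) set \<Rightarrow> bool" where
  "dag V E \<longleftrightarrow> finite V \<and> E \<subseteq> V \<times> V \<and> acyclic E"

definition transitive_dag :: "('v \<times> 'v) set \<Rightarrow> bool" where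
  "transitive_dag E \<longleftrightarrow> (\<forall>i k. (i, k) \<in> E\<^sup>+ \<longrightarrow> (i, k) \<in> E)"

definition pa :: "('v \<times> 'v) set \<Rightarrow> 'v \<Rightarrow> 'v set" where
  "pa E v = {u. (u, v) \<in> E}"

text \<open>Total orderings of \<open>V\<close> are given as the list of the vertices in increasing order.\<close>

definition topological_ordering :: "'v set \<Rightarrow> ('v \<times> 'v) set \<Rightarrow> 'v list \<Rightarrow> bool" where
  "topological_ordering V E vs \<longleftrightarrow> distinct vs \<and> set vs = V \<and>
     (\<forall>i<length vs. \<forall>j<length vs. (vs ! i, vs ! j) \<in> E \<longrightarrow> i < j)"

section \<open>Quantum kernels\<close>

definition kernel_family ::
  "'v set \<Rightarrow> ('v \<times> 'v) set \<Rightarrow> ('v \<Rightarrow> nat) \<Rightarrow> ('v \<Rightarrow> ('v \<Rightarrow> nat) cmatrix) \<Rightarrow> bool" where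
  "kernel_family V E d Q \<longleftrightarrow> (\<forall>v\<in>V.
     positive_definite (idx d (insert v (pa E v))) (Q v) \<and>
     partial_trace d (insert v (pa E v)) (pa E v) (Q v) = op_id (idx d (pa E v)))"

text \<open>
  \<open>partial_state E d Q vs j\<close> is the operator built from the first \<open>j\<close> vertices of \<open>vs\<close>; the value
  for \<open>j = 0\<close> only matters for the empty graph.
\<close>

fun partial_state ::
  "('v \<times> 'v) set \<Rightarrow> ('v \<Rightarrow> nat) \<Rightarrow> ('v \<Rightarrow> ('v \<Rightarrow> nat) cmatrix) \<Rightarrow> 'v list \<Rightarrow> nat
   \<Rightarrow> ('v \<Rightarrow> nat) cmatrix" where
  "partial_state E d Q vs 0 = op_id (idx d {})"
| "partial_state E d Q vs (Suc 0) = Q (vs ! 0)"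
| "partial_state E d Q vs (Suc (Suc j)) =
     (let v = vs ! Suc j; U = set (take (Suc j) vs); W = set (take (Suc (Suc j)) vs)
      in op_star (idx d W)
           (embed d (insert v (pa E v)) W (Q v))
           (embed d U W (partial_state E d Q vs (Suc j))))"

definition ordered_state ::
  "('v \<times> 'v) set \<Rightarrow> ('v \<Rightarrow> nat) \<Rightarrow> ('v \<Rightarrow> ('v \<Rightarrow> nat) cmatrix) \<Rightarrow> 'v list
   \<Rightarrow> ('v \<Rightarrow> nat) cmatrix" where
  "ordered_state E d Q vs = partial_state E d Q vs (length vs)"

definition order_invariant ::
  "'v set \<Rightarrow> ('v \<times> 'v) set \<Rightarrow> ('v \<Rightarrow> nat) \<Rightarrow> ('v \<Rightarrow> ('v \<Rightarrow> nat) cmatrix) \<Rightarrow> bool" where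
  "order_invariant V E d Q \<longleftrightarrow>
     (\<forall>vs ws. topological_ordering V E vs \<longrightarrow> topological_ordering V E ws \<longrightarrow>
        ordered_state E d Q vs = ordered_state E d Q ws)"

text \<open>Well defined for order-invariant \<open>Q\<close>, since a finite DAG has a topological ordering.\<close>

definition common_state ::
  "'v set \<Rightarrow> ('v \<times> 'v) set \<Rightarrow> ('v \<Rightarrow> nat) \<Rightarrow> ('v \<Rightarrow> ('v \<Rightarrow> nat) cmatrix)
   \<Rightarrow> ('v \<Rightarrow> nat) cmatrix" where
  "common_state V E d Q =
     (THE \<rho>. \<forall>vs. topological_ordering V E vs \<longrightarrow> ordered_state E d Q vs = \<rho>)"

text \<open>
  The Markov property is required for one topological ordering; for states this is equivalent to
  requiring it for every one. The predecessors of \<open>vs ! j\<close> are \<open>set (take j vs)\<close>.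
\<close>

definition directed_quantum_markov ::
  "'v set \<Rightarrow> ('v \<times> 'v) set \<Rightarrow> ('v \<Rightarrow> nat) \<Rightarrow> ('v \<Rightarrow> nat) cmatrix \<Rightarrow> bool" where
  "directed_quantum_markov V E d \<rho> \<longleftrightarrow>
     (\<exists>vs. topological_ordering V E vs \<and>
       (\<forall>j<length vs. cond_indep d V \<rho> {vs ! j} (set (take j vs) - pa E (vs ! j)) (pa E (vs ! j))))"

end

theory Submission
  imports Defs
begin

text \<open>
  A graph that is not transitive contains an induced chain \<open>i \<rightarrow> j \<rightarrow> k\<close>. Put a qubit on each of its three
  vertices and \<open>\<complex>\<close> on all others. Every topological ordering lists \<open>i, j, k\<close> in this order and the
  remaining kernels are identities, so order invariance is automatic. With the kernels \<open>I/2\<close>,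
  \<open>(I + 3/5 Z\<^sub>i Z\<^sub>j)/2\<close> and \<open>(I + 9/16 X\<^sub>j Z\<^sub>k)/2\<close> the state is \<open>(I + 3/5 Z\<^sub>i Z\<^sub>j + 9/20 X\<^sub>j Z\<^sub>k)/8\<close>. As the
  two Pauli products anticommute, this has the form \<open>(I + 3/4 K)/8\<close> with a traceless involution \<open>K\<close>,
  and the marginals have the same form with the biases \<open>3/5\<close>, \<open>9/20\<close>, \<open>0\<close> instead of \<open>3/4\<close>. If \<open>D r\<close>
  is the entropy that a bit loses by the bias \<open>r\<close>, then \<open>I(k : i | j) = D (3/4) - D (3/5) - D (9/20) > 0\<close>.
\<close>

section \<open>Functional calculus of combinations of the identity and an involution\<close>

definition op_comb :: "real \<Rightarrow> 'i cmatrix \<Rightarrow> real \<Rightarrow> 'i cmatrix \<Rightarrow> 'i cmatrix" where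
  "op_comb a M b N = (\<lambda>x y. complex_of_real a * M x y + complex_of_real b * N x y)"

text \<open>Equality is asked only where the coefficient is nonzero. This lets
  \<open>embed_pauli\<close> be applied to a Pauli product only when its support lies in the smaller
  vertex set.\<close>

lemma op_comb_cong:
  assumes "a \<noteq> 0 \<Longrightarrow> M = M'" and "b \<noteq> 0 \<Longrightarrow> N = N'"
  shows "op_comb a M b N = op_comb a M' b N'"
  using assms by (cases "a = 0"; cases "b = 0") (auto simp: op_comb_def)

lemma op_mult_comb_left:
  "op_mult I (op_comb a M b N) L = op_comb a (op_mult I M L) b (op_mult I N L)"
  by (simp add: op_mult_def op_comb_def sum.distrib sum_distrib_left algebra_simps)

lemma op_mult_comb_right:
  "op_mult I L (op_comb a M b N) = op_comb a (op_mult I L M) b (op_mult I L N)"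
  by (simp add: op_mult_def op_comb_def sum.distrib sum_distrib_left algebra_simps)

lemma op_trace_comb:
  "op_trace I (op_comb a M b N) = complex_of_real a * op_trace I M + complex_of_real b * op_trace I N"
  by (simp add: op_trace_def op_comb_def sum.distrib sum_distrib_left)

lemma op_comb_operators:
  "M \<in> operators I \<Longrightarrow> N \<in> operators I \<Longrightarrow> op_comb a M b N \<in> operators I"
  by (auto simp: operators_def op_comb_def)

lemma op_id_operators: "op_id I \<in> operators I"
  by (auto simp: operators_def op_id_def)

lemma op_mult_id_left:
  assumes "finite I" and "M \<in> operators I"
  shows "op_mult I (op_id I) M = M"
proof (intro ext)
  fix x y
  have "op_mult I (op_id I) M x y = (\<Sum>z\<in>I. if x = z then M x y else 0)"
    unfolding op_mult_def op_id_def by (intro sum.cong) auto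
  also have "\<dots> = M x y"
    using assms by (simp add: operators_def)
  finally show "op_mult I (op_id I) M x y = M x y" .
qed

lemma op_mult_id_right:
  assumes "finite I" and "M \<in> operators I"
  shows "op_mult I M (op_id I) = M"
proof (intro ext)
  fix x y
  have "op_mult I M (op_id I) x y = (\<Sum>z\<in>I. if z = y then M x y else 0)"
    unfolding op_mult_def op_id_def by (intro sum.cong) auto
  also have "\<dots> = M x y"
    using assms by (simp add: operators_def)
  finally show "op_mult I M (op_id I) x y = M x y" .
qed

lemma op_apply_mult: "op_apply I M (op_apply I N \<psi>) x = op_apply I (op_mult I M N) \<psi> x"
proof -
  have "op_apply I M (op_apply I N \<psi>) x = (\<Sum>y\<in>I. \<Sum>z\<in>I. M x y * N y z * \<psi> z)"
    by (simp add: op_apply_def sum_distrib_left mult.assoc)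
  also have "\<dots> = (\<Sum>z\<in>I. \<Sum>y\<in>I. M x y * N y z * \<psi> z)"
    by (rule sum.swap)
  finally show ?thesis
    by (simp add: op_apply_def op_mult_def sum_distrib_right)
qed

lemma op_mult_assoc: "op_mult I (op_mult I L M) N = op_mult I L (op_mult I M N)"
proof (intro ext)
  fix x y
  have "op_mult I (op_mult I L M) N x y = (\<Sum>z\<in>I. \<Sum>w\<in>I. L x w * M w z * N z y)"
    by (simp add: op_mult_def sum_distrib_right)
  also have "\<dots> = (\<Sum>w\<in>I. \<Sum>z\<in>I. L x w * M w z * N z y)"
    by (rule sum.swap)
  finally show "op_mult I (op_mult I L M) N x y = op_mult I L (op_mult I M N) x y"
    by (simp add: op_mult_def sum_distrib_left mult.assoc)
qed

lemma op_apply_id: "finite I \<Longrightarrow> x \<in> I \<Longrightarrow> op_apply I (op_id I) \<psi> x = \<psi> x"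
  by (simp add: op_apply_def op_id_def if_distrib[of "\<lambda>c. c * _"] cong: if_cong)

lemma op_apply_comb:
  "op_apply I (op_comb a M b N) \<psi> x =
     complex_of_real a * op_apply I M \<psi> x + complex_of_real b * op_apply I N \<psi> x"
  by (simp add: op_apply_def op_comb_def sum.distrib sum_distrib_left algebra_simps)

lemma op_apply_lin:
  "op_apply I M (\<lambda>y. a * \<phi> y + b * \<psi> y) x = a * op_apply I M \<phi> x + b * op_apply I M \<psi> x"
  by (simp add: op_apply_def sum.distrib sum_distrib_left algebra_simps)

lemma op_apply_cong: "(\<And>y. y \<in> I \<Longrightarrow> \<phi> y = \<psi> y) \<Longrightarrow> op_apply I M \<phi> x = op_apply I M \<psi> x"
  by (auto simp: op_apply_def)

text \<open>The spectral projections are \<open>(id \<plusminus> K) / 2\<close>.\<close>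

lemma op_fun_involution:
  fixes m r :: real
  assumes fin: "finite I" and K: "K \<in> operators I" and KK: "op_mult I K K = op_id I"
  shows "op_fun I f (op_comb m (op_id I) (m * r) K) =
           op_comb ((f (m * (1 + r)) + f (m * (1 - r))) / 2) (op_id I)
             ((f (m * (1 + r)) - f (m * (1 - r))) / 2) K" (is "op_fun I f ?M = ?F")
  unfolding op_fun_def
proof (rule the_equality)
  define p q where "p = f (m * (1 + r))" and "q = f (m * (1 - r))"
  have Kinv: "op_apply I K (op_apply I K \<psi>) x = \<psi> x" if "x \<in> I" for \<psi> x
    using that fin by (simp add: op_apply_mult KK op_apply_id)
  show "?F \<in> operators I \<and> (\<forall>c \<psi>. (\<forall>x\<in>I. op_apply I ?M \<psi> x = complex_of_real c * \<psi> x) \<longrightarrow>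
            (\<forall>x\<in>I. op_apply I ?F \<psi> x = complex_of_real (f c) * \<psi> x))"
  proof (intro conjI allI impI ballI)
    show "?F \<in> operators I"
      by (intro op_comb_operators op_id_operators K)
    fix c \<psi> x
    assume eig: "\<forall>x\<in>I. op_apply I ?M \<psi> x = complex_of_real c * \<psi> x" and x: "x \<in> I"
    define \<kappa> where "\<kappa> = op_apply I K \<psi>"
    have e1: "complex_of_real m * \<psi> y + complex_of_real (m * r) * \<kappa> y = complex_of_real c * \<psi> y"
      if "y \<in> I" for y
      using eig that fin by (simp add: op_apply_comb op_apply_id \<kappa>_def)
    \<comment> \<open>Applying \<open>K\<close> to the eigenvalue equation \<open>e1\<close> and
      using that \<open>K\<close> is an involution exchanges the roles of \<open>\<psi>\<close> and
      \<open>\<kappa>\<close>.\<close>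
    have "op_apply I K (\<lambda>y. complex_of_real m * \<psi> y + complex_of_real (m * r) * \<kappa> y) x
        = op_apply I K (\<lambda>y. complex_of_real c * \<psi> y + 0 * \<psi> y) x"
      by (rule op_apply_cong) (use e1 in simp)
    then have e2: "complex_of_real m * \<kappa> x + complex_of_real (m * r) * \<psi> x = complex_of_real c * \<kappa> x"
      unfolding op_apply_lin using Kinv[OF x, of \<psi>] by (simp add: \<kappa>_def)
    \<comment> \<open>Up to the factor 2, \<open>\<psi> + \<kappa>\<close> and
      \<open>\<psi> - \<kappa>\<close> are the spectral components of \<open>\<psi>\<close>. Adding
      and subtracting \<open>e1\<close> and \<open>e2\<close> shows that each one vanishes or has
      eigenvalue \<open>c\<close>.\<close>
    have "(complex_of_real (m * (1 + r)) - complex_of_real c) * (\<psi> x + \<kappa> x) = 0"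
      using e1[OF x] e2 by (simp add: algebra_simps) (metis add.assoc add.commute)
    then have c1: "\<psi> x + \<kappa> x = 0 \<or> m * (1 + r) = c"
      by (metis mult_eq_0_iff of_real_eq_iff right_minus_eq)
    have "(complex_of_real (m * (1 - r)) - complex_of_real c) * (\<psi> x - \<kappa> x) =
      (complex_of_real m * \<psi> x + complex_of_real (m * r) * \<kappa> x - complex_of_real c * \<psi> x)
     - (complex_of_real m * \<kappa> x + complex_of_real (m * r) * \<psi> x - complex_of_real c * \<kappa> x)"
      by (simp add: algebra_simps)
    also have "\<dots> = 0"
      using e1[OF x] e2 by simp
    finally have c2: "\<psi> x - \<kappa> x = 0 \<or> m * (1 - r) = c"
      by (metis mult_eq_0_iff of_real_eq_iff right_minus_eq)
    have "op_apply I ?F \<psi> x =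
        complex_of_real p * ((\<psi> x + \<kappa> x) / 2) + complex_of_real q * ((\<psi> x - \<kappa> x) / 2)"
      using x fin unfolding op_apply_comb p_def[symmetric] q_def[symmetric]
      by (simp add: op_apply_id \<kappa>_def field_simps)
    also have "complex_of_real p * ((\<psi> x + \<kappa> x) / 2) = complex_of_real (f c) * ((\<psi> x + \<kappa> x) / 2)"
      using c1 by (auto simp: p_def)
    also have "complex_of_real q * ((\<psi> x - \<kappa> x) / 2) = complex_of_real (f c) * ((\<psi> x - \<kappa> x) / 2)"
      using c2 by (auto simp: q_def)
    finally show "op_apply I ?F \<psi> x = complex_of_real (f c) * \<psi> x"
      by (simp add: field_simps)
  qed
  fix F
  assume F: "F \<in> operators I \<and> (\<forall>c \<psi>. (\<forall>x\<in>I. op_apply I ?M \<psi> x = complex_of_real c * \<psi> x) \<longrightarrow>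
            (\<forall>x\<in>I. op_apply I F \<psi> x = complex_of_real (f c) * \<psi> x))"
  show "F = ?F"
  proof (intro ext)
    fix x y
    show "F x y = ?F x y"
    proof (cases "x \<in> I \<and> y \<in> I")
      case False
      then show ?thesis
        using F K by (auto simp: operators_def op_comb_def op_id_def)
    next
      case True
      \<comment> \<open>For uniqueness, column \<open>y\<close> of \<open>F\<close> is computed. The
        basis vector \<open>\<phi>\<close> is half the sum of \<open>\<phi> + \<kappa>\<close> and
        \<open>\<phi> - \<kappa>\<close>, on which \<open>M\<close> acts by the scalars
        \<open>m * (1 + r)\<close> and \<open>m * (1 - r)\<close>, so the action of \<open>F\<close>
        on both is prescribed.\<close>
      define \<phi> :: "_ \<Rightarrow> complex" where "\<phi> = (\<lambda>z. if z = y then 1 else 0)"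
      have ap: "op_apply I N \<phi> z = N z y" for N z
        using True fin by (simp add: op_apply_def \<phi>_def if_distrib[of "\<lambda>c. _ * c"] cong: if_cong)
      define \<kappa> where "\<kappa> = op_apply I K \<phi>"
      have eig: "op_apply I ?M (\<lambda>y. 1 * \<phi> y + complex_of_real s * \<kappa> y) z =
                 complex_of_real (m * (1 + s * r)) * (1 * \<phi> z + complex_of_real s * \<kappa> z)"
        if "z \<in> I" and "s * s = 1" for z s
      proof -
        have ss: "complex_of_real s * complex_of_real s = 1"
          using that(2) by (metis of_real_1 of_real_mult)
        have "op_apply I K \<kappa> z = \<phi> z"
          using Kinv that by (simp add: \<kappa>_def)
        moreover have "complex_of_real s * (complex_of_real s * w) = w" for w
          using ss by (simp flip: mult.assoc)
        ultimately show ?thesis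
          unfolding op_apply_comb op_apply_lin using that fin
          by (simp add: op_apply_id \<kappa>_def[symmetric] algebra_simps)
      qed
      have Feig: "op_apply I F (\<lambda>y. 1 * \<phi> y + complex_of_real s * \<kappa> y) x =
                 complex_of_real (f (m * (1 + s * r))) * (1 * \<phi> x + complex_of_real s * \<kappa> x)"
        if "s * s = 1" for s
        using F eig[OF _ that] True by blast
      have f1: "F x y + op_apply I F \<kappa> x = complex_of_real p * (\<phi> x + \<kappa> x)"
        using Feig[of 1] unfolding op_apply_lin by (simp add: ap p_def)
      have f2: "F x y - op_apply I F \<kappa> x = complex_of_real q * (\<phi> x - \<kappa> x)"
        using Feig[of "-1"] unfolding op_apply_lin by (simp add: ap q_def)
      have "2 * F x y = (F x y + op_apply I F \<kappa> x) + (F x y - op_apply I F \<kappa> x)"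
        by simp
      also have "\<dots> = 2 * ?F x y"
        unfolding f1 f2 p_def q_def using True ap[of K] by (simp add: op_comb_def op_id_def \<phi>_def \<kappa>_def field_simps)
      finally show ?thesis
        by simp
    qed
  qed
qed

lemma op_mult_comb_involution:
  assumes "finite I" and "K \<in> operators I" and "op_mult I K K = op_id I"
  shows "op_mult I (op_comb a (op_id I) b K) (op_comb c (op_id I) e K) =
         op_comb (a * c + b * e) (op_id I) (a * e + b * c) K"
  by (simp add: op_mult_comb_left op_mult_comb_right assms op_mult_id_left op_mult_id_right
      op_id_operators) (simp add: op_comb_def algebra_simps fun_eq_iff)

text \<open>The hypotheses make the two spectral values \<open>m * (1 + r)\<close> and
  \<open>m * (1 - r)\<close> nonnegative, so their real square roots square back to them.\<close>

lemma sqrt_involution_squared: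
  assumes "finite I" and "K \<in> operators I" and "op_mult I K K = op_id I"
    and "0 \<le> m" and "\<bar>r\<bar> \<le> 1"
  defines "M \<equiv> op_comb m (op_id I) (m * r) K"
  shows "op_mult I (op_fun I sqrt M) (op_fun I sqrt M) = M"
proof -
  define u v where "u = sqrt (m * (1 + r))" and "v = sqrt (m * (1 - r))"
  have uv: "u * u = m * (1 + r)" "v * v = m * (1 - r)"
    using assms(4,5) by (simp_all add: u_def v_def)
  have "(u + v) / 2 * ((u + v) / 2) + (u - v) / 2 * ((u - v) / 2) = (u * u + v * v) / 2"
    by (simp add: field_simps)
  moreover have "(u + v) / 2 * ((u - v) / 2) + (u - v) / 2 * ((u + v) / 2) = (u * u - v * v) / 2"
    by (simp add: field_simps)
  ultimately show ?thesis
    unfolding M_def op_fun_involution[OF assms(1-3)] op_mult_comb_involution[OF assms(1-3)]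
      u_def[symmetric] v_def[symmetric] uv by (simp add: algebra_simps add_divide_distrib[symmetric])
qed

text \<open>This is \<open>ln 2\<close> minus the Shannon entropy of a bit with probabilities
  \<open>(1 + r) / 2\<close> and \<open>(1 - r) / 2\<close>; the overview calls it
  \<open>D\<close>.\<close>

definition bias_deficit :: "real \<Rightarrow> real" where
  "bias_deficit r = ((1 + r) * ln (1 + r) + (1 - r) * ln (1 - r)) / 2"

text \<open>A traceless involution has both eigenvalues with equal multiplicity, so the spectrum is
  that of a bit of bias \<open>r\<close> times a uniform distribution. For \<open>r = 0\<close> the
  coefficient of \<open>K\<close> in the product vanishes, which admits the identity as
  \<open>K\<close>.\<close>

lemma trace_log_involution:
  assumes fin: "finite I" and K: "K \<in> operators I" "op_mult I K K = op_id I"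
    and tr: "r \<noteq> 0 \<Longrightarrow> op_trace I K = 0" and r: "\<bar>r\<bar> < 1" and I: "I \<noteq> {}"
  defines "M \<equiv> op_comb (1 / card I) (op_id I) (1 / card I * r) K"
  shows "- Re (op_trace I (op_mult I M (op_fun I ln M))) = ln (card I) - bias_deficit r"
proof -
  define n where "n = real (card I)"
  have n: "n > 0"
    using fin I by (simp add: n_def card_gt_0_iff)
  define u v where "u = ln (1 / n * (1 + r))" and "v = ln (1 / n * (1 - r))"
  have uv: "u = ln (1 + r) - ln n" "v = ln (1 - r) - ln n"
    using n r by (simp_all add: u_def v_def ln_divide_pos)
  have tid: "op_trace I (op_id I) = of_real n"
    by (simp add: op_trace_def op_id_def n_def)
  have "op_trace I (op_mult I M (op_fun I ln M)) =
      complex_of_real (1 / n * ((u + v) / 2) + 1 / n * r * ((u - v) / 2)) * of_real n +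
      complex_of_real (1 / n * ((u - v) / 2) + 1 / n * r * ((u + v) / 2)) * op_trace I K"
    unfolding M_def op_fun_involution[OF fin K] op_mult_comb_involution[OF fin K] op_trace_comb tid
    by (simp add: n_def u_def v_def)
  also have "complex_of_real (1 / n * ((u - v) / 2) + 1 / n * r * ((u + v) / 2)) * op_trace I K = 0"
    using tr by (cases "r = 0") (simp_all add: u_def v_def)
  finally have "Re (op_trace I (op_mult I M (op_fun I ln M))) =
      (1 / n * ((u + v) / 2) + 1 / n * r * ((u - v) / 2)) * n"
    by simp
  also have "\<dots> = ((1 + r) * u + (1 - r) * v) / 2"
    using n by (simp add: field_simps)
  also have "\<dots> = bias_deficit r - ln n"
    by (simp add: uv bias_deficit_def field_simps)
  finally show ?thesis
    by (simp add: n_def)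
qed

section \<open>Pauli operators\<close>

text \<open>Subtraction on naturals exchanges 0 and 1 but is no involution on larger values, hence
  the assumption \<open>d v = 2\<close> on \<open>F\<close> wherever the flip has to be
  undone.\<close>

definition flip :: "'v set \<Rightarrow> ('v \<Rightarrow> nat) \<Rightarrow> 'v \<Rightarrow> nat" where
  "flip F x = (\<lambda>v. if v \<in> F then 1 - x v else x v)"

definition phase :: "'v set \<Rightarrow> ('v \<Rightarrow> nat) \<Rightarrow> complex" where
  "phase S x = (\<Prod>v\<in>S. (-1) ^ x v)"

text \<open>The Pauli matrix \<open>Z\<close> at the vertices in \<open>S\<close>, multiplied on the right by \<open>X\<close> at those in \<open>F\<close>.\<close>

definition pauli :: "('v \<Rightarrow> nat) \<Rightarrow> 'v set \<Rightarrow> 'v set \<Rightarrow> 'v set \<Rightarrow> ('v \<Rightarrow> nat) cmatrix" where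
  "pauli d A F S = (\<lambda>x y. if x \<in> idx d A \<and> y = flip F x then phase S x else 0)"

section \<open>Index sets, bit flips and phases\<close>

lemma finite_idx: "finite A \<Longrightarrow> finite (idx d A)"
  by (simp add: idx_def finite_PiE)

lemma card_idx: "finite A \<Longrightarrow> card (idx d A) = (\<Prod>v\<in>A. d v)"
  by (simp add: idx_def card_PiE)

lemma idx_less: "x \<in> idx d A \<Longrightarrow> v \<in> A \<Longrightarrow> x v < d v"
  by (simp add: idx_def PiE_iff)

lemma flip_in_idx:
  assumes "F \<subseteq> A" and "\<forall>v\<in>F. d v = 2" and "x \<in> idx d A"
  shows "flip F x \<in> idx d A"
  using assms by (auto simp: idx_def PiE_iff flip_def extensional_def)

lemma flip_flip:
  assumes "F \<subseteq> A" and "\<forall>v\<in>F. d v = 2" and "x \<in> idx d A"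
  shows "flip F (flip F x) = x"
proof
  fix v
  have "x v < 2" if "v \<in> F"
    using assms that idx_less[OF assms(3), of v] by auto
  then show "flip F (flip F x) v = x v"
    by (cases "v \<in> F") (auto simp: flip_def)
qed

lemma bij_betw_flip:
  assumes "F \<subseteq> A" and "\<forall>v\<in>F. d v = 2"
  shows "bij_betw (flip F) (idx d A) (idx d A)"
  by (rule bij_betw_byWitness[where f' = "flip F"]) (use flip_flip[OF assms] flip_in_idx[OF assms] in auto)

lemma flip_empty [simp]: "flip {} x = x"
  by (simp add: flip_def)

lemma phase_square: "phase S x * phase S x = 1"
  by (simp add: phase_def prod.distrib[symmetric] power_add[symmetric] mult_2[symmetric])

lemma phase_flip_disjoint: "F \<inter> S = {} \<Longrightarrow> phase S (flip F x) = phase S x"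
  unfolding phase_def flip_def by (rule prod.cong) auto

lemma phase_flip_single:
  assumes "finite S" and "w \<in> S" and "x w < 2"
  shows "phase S (flip {w} x) = - phase S x"
proof -
  have "(-1 :: complex) ^ (1 - x w) = - ((-1) ^ x w)"
    using assms(3) by (cases "x w = 0") (auto simp: less_2_cases_iff)
  moreover have "(\<Prod>v\<in>S - {w}. (-1 :: complex) ^ flip {w} x v) = (\<Prod>v\<in>S - {w}. (-1) ^ x v)"
    by (rule prod.cong) (auto simp: flip_def)
  ultimately show ?thesis
    using assms(1,2) by (simp add: phase_def prod.remove[of S w] flip_def)
qed

text \<open>Reindexing by the flip at \<open>w\<close> shows that the sum is its own negative.
  Traces and partial traces over a vertex carrying only a \<open>Z\<close> vanish for this
  reason.\<close>

lemma sum_eq_0_by_flip: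
  fixes g :: "('v \<Rightarrow> nat) \<Rightarrow> complex"
  assumes "w \<in> A" and "d w = 2" and "\<And>x. x \<in> idx d A \<Longrightarrow> g (flip {w} x) = - g x"
  shows "(\<Sum>x\<in>idx d A. g x) = 0"
proof -
  have "(\<Sum>x\<in>idx d A. g x) = (\<Sum>x\<in>idx d A. g (flip {w} x))"
    by (rule sum.reindex_bij_betw[OF bij_betw_flip, symmetric]) (use assms in auto)
  also have "\<dots> = - (\<Sum>x\<in>idx d A. g x)"
    using assms(3) by (simp add: sum_negf)
  finally show ?thesis
    by simp
qed

section \<open>Products and traces of Pauli operators\<close>

lemma op_id_eq_pauli: "op_id (idx d A) = pauli d A {} {}"
  by (auto simp: op_id_def pauli_def phase_def fun_eq_iff)

lemma pauli_operators:
  assumes "F \<subseteq> A" and "\<forall>v\<in>F. d v = 2"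
  shows "pauli d A F S \<in> operators (idx d A)"
  using flip_in_idx[OF assms] by (auto simp: operators_def pauli_def)

lemma op_mult_pauli:
  assumes "finite A" and "F \<subseteq> A" and "\<forall>v\<in>F. d v = 2"
  shows "op_mult (idx d A) (pauli d A F S) M x y =
         (if x \<in> idx d A then phase S x * M (flip F x) y else 0)"
proof -
  have "op_mult (idx d A) (pauli d A F S) M x y =
      (\<Sum>z\<in>idx d A. if z = flip F x then (if x \<in> idx d A then phase S x * M (flip F x) y else 0) else 0)"
    unfolding op_mult_def pauli_def by (rule sum.cong) auto
  then show ?thesis
    using assms(1) flip_in_idx[OF assms(2,3)] by (auto simp: finite_idx)
qed

text \<open>As \<open>F\<close> and \<open>S\<close> are disjoint, the flip leaves the phase
  unchanged, and the two equal signs multiply to 1.\<close>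

lemma pauli_involution:
  assumes "finite A" and "F \<subseteq> A" and "\<forall>v\<in>F. d v = 2" and "F \<inter> S = {}"
  shows "op_mult (idx d A) (pauli d A F S) (pauli d A F S) = op_id (idx d A)"
proof (intro ext)
  fix x y
  show "op_mult (idx d A) (pauli d A F S) (pauli d A F S) x y = op_id (idx d A) x y"
    unfolding op_mult_pauli[OF assms(1-3)] using flip_flip[OF assms(2,3)] flip_in_idx[OF assms(2,3)]
    by (auto simp: op_id_def pauli_def phase_flip_disjoint[OF assms(4)] phase_square)
qed

text \<open>The flip at \<open>w\<close> moves every basis index, so all diagonal entries are
  zero.\<close>

lemma op_trace_pauli_flip:
  assumes "w \<in> F" and "F \<subseteq> A" and "d w = 2"
  shows "op_trace (idx d A) (pauli d A F S) = 0"
  unfolding op_trace_def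
proof (rule sum.neutral, rule ballI)
  fix x assume "x \<in> idx d A"
  then have "x w < 2"
    using assms idx_less[of x d A w] by auto
  then have "flip F x w \<noteq> x w"
    using assms(1) by (cases "x w = 0") (auto simp: flip_def)
  then show "pauli d A F S x x = 0"
    by (auto simp: pauli_def)
qed

lemma op_trace_pauli_phase:
  assumes "finite S" and "w \<in> S" and "w \<in> A" and "d w = 2"
  shows "op_trace (idx d A) (pauli d A {} S) = 0"
  unfolding op_trace_def
proof (rule sum_eq_0_by_flip[where w = w])
  fix x assume x: "x \<in> idx d A"
  then have "x w < 2"
    using assms idx_less[of x d A w] by auto
  moreover have "flip {w} x \<in> idx d A"
    by (rule flip_in_idx) (use assms x in auto)
  ultimately show "pauli d A {} S (flip {w} x) (flip {w} x) = - pauli d A {} S x x"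
    using x phase_flip_single[OF assms(1,2)] by (simp add: pauli_def)
qed (use assms in auto)

section \<open>Embeddings and partial traces of Pauli operators\<close>

lemma embed_comb: "embed d A B (op_comb a M b N) = op_comb a (embed d A B M) b (embed d A B N)"
  by (auto simp: embed_def op_comb_def fun_eq_iff)

lemma embed_pauli:
  assumes "A \<subseteq> B" and "F \<subseteq> A" and "S \<subseteq> A" and "\<forall>v\<in>F. d v = 2"
  shows "embed d A B (pauli d A F S) = pauli d B F S"
proof (intro ext)
  fix x y
  have F: "flip F x \<in> idx d B" if "x \<in> idx d B"
    by (rule flip_in_idx) (use assms that in auto)
  have r: "restrict x A \<in> idx d A" if "x \<in> idx d B"
    using that assms(1) by (auto simp: idx_def PiE_iff)
  \<comment> \<open>The agreement outside \<open>A\<close> demanded by \<open>embed\<close> and the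
    flip inside \<open>A\<close> combine to a single flip on \<open>B\<close>, because
    \<open>F\<close> lies in \<open>A\<close>. Outside \<open>B\<close> both indices are
    \<open>undefined\<close>.\<close>
  have e: "(\<forall>v\<in>B - A. x v = y v) \<and> restrict y A = flip F (restrict x A) \<longleftrightarrow> y = flip F x"
    if "x \<in> idx d B" "y \<in> idx d B"
  proof
    assume "y = flip F x"
    then show "(\<forall>v\<in>B - A. x v = y v) \<and> restrict y A = flip F (restrict x A)"
      using assms(2) by (auto simp: flip_def restrict_def fun_eq_iff)
  next
    assume h: "(\<forall>v\<in>B - A. x v = y v) \<and> restrict y A = flip F (restrict x A)"
    show "y = flip F x"
    proof
      fix v
      consider "v \<in> A" | "v \<in> B - A" | "v \<notin> B" using assms(1) by auto
      then show "y v = flip F x v"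
      proof cases
        case 1
        with h have "restrict y A v = flip F (restrict x A) v" by simp
        with 1 show ?thesis by (simp add: flip_def)
      next
        case 2
        with h assms(2) show ?thesis by (auto simp: flip_def)
      next
        case 3
        with that assms(1,2) show ?thesis by (auto simp: flip_def idx_def PiE_iff extensional_def)
      qed
    qed
  qed
  have p: "phase S (restrict x A) = phase S x"
    unfolding phase_def by (rule prod.cong) (use assms(3) in auto)
  show "embed d A B (pauli d A F S) x y = pauli d B F S x y"
  proof (cases "x \<in> idx d B \<and> y \<in> idx d B")
    case True
    then show ?thesis
      using e r p by (cases "y = flip F x") (auto simp: embed_def pauli_def)
  next
    case False
    then show ?thesis
      using F by (auto simp: embed_def pauli_def)
  qed
qed

lemma partial_trace_comb:
  "partial_trace d B A (op_comb a M b N) = op_comb a (partial_trace d B A M) b (partial_trace d B A N)"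
  by (auto simp: partial_trace_def op_comb_def fun_eq_iff sum.distrib sum_distrib_left)

lemma override_in_idx:
  assumes "A \<subseteq> B" and "x \<in> idx d A" and "z \<in> idx d (B - A)"
  shows "override_on x z (B - A) \<in> idx d B"
  using assms by (auto simp: idx_def PiE_iff override_on_def extensional_def)

lemma override_eq_flip_iff:
  assumes "F \<subseteq> A"  and "x \<in> idx d A" and "y \<in> idx d A"
  shows "override_on y z (B - A) = flip F (override_on x z (B - A)) \<longleftrightarrow> y = flip F x"
proof
  assume h: "override_on y z (B - A) = flip F (override_on x z (B - A))"
  show "y = flip F x"
  proof
    fix v
    show "y v = flip F x v"
    proof (cases "v \<in> A")
      case True
      then show ?thesis
        using fun_cong[OF h, of v] by (auto simp: override_on_def flip_def)
    next
      case False
      then show ?thesis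
        using assms by (auto simp: flip_def idx_def PiE_iff extensional_def)
    qed
  qed
next
  assume "y = flip F x"
  then show "override_on y z (B - A) = flip F (override_on x z (B - A))"
    using assms(1) by (auto simp: override_on_def flip_def fun_eq_iff)
qed

text \<open>With \<open>F\<close> and \<open>S\<close> inside \<open>A\<close>, every traced-out
  index contributes the same entry, so the trace counts these indices. The scalar multiple is
  written as an \<open>op_comb\<close> with second coefficient 0.\<close>

lemma partial_trace_pauli:
  assumes "finite B" and "A \<subseteq> B" and "F \<subseteq> A" and "S \<subseteq> A" and "\<forall>v\<in>F. d v = 2"
  shows "partial_trace d B A (pauli d B F S) =
         op_comb (card (idx d (B - A))) (pauli d A F S) 0 (pauli d A F S)"
proof (intro ext)
  fix x y
  have "pauli d B F S (override_on x z (B - A)) (override_on y z (B - A)) = pauli d A F S x y"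
    if "x \<in> idx d A" "y \<in> idx d A" "z \<in> idx d (B - A)" for z
  proof -
    have "phase S (override_on x z (B - A)) = phase S x"
      unfolding phase_def by (rule prod.cong) (use assms(4) in \<open>auto simp: override_on_def\<close>)
    then show ?thesis
      using that override_in_idx[OF assms(2) that(1,3)] override_eq_flip_iff[OF assms(3) that(1,2)]
      by (simp add: pauli_def)
  qed
  moreover have "pauli d A F S x y = 0" if "\<not> (x \<in> idx d A \<and> y \<in> idx d A)"
    using that flip_in_idx[OF assms(3,5)] by (auto simp: pauli_def)
  ultimately show "partial_trace d B A (pauli d B F S) x y =
      op_comb (card (idx d (B - A))) (pauli d A F S) 0 (pauli d A F S) x y"
    by (auto simp: partial_trace_def op_comb_def)
qed

text \<open>The vertex \<open>w\<close> is traced out and carries a \<open>Z\<close> but no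
  \<open>X\<close>, since \<open>F\<close> lies in \<open>A\<close>. Flipping it in the summation
  index changes only the sign of the summand.\<close>

lemma partial_trace_pauli_eq_0:
  assumes "A \<subseteq> B" and "F \<subseteq> A" and "finite S" and "w \<in> S" and "w \<in> B - A" and "d w = 2"
  shows "partial_trace d B A (pauli d B F S) = (\<lambda>_ _. 0)"
proof (intro ext)
  fix x y
  have "(\<Sum>z\<in>idx d (B - A). pauli d B F S (override_on x z (B - A)) (override_on y z (B - A))) = 0"
    if xy: "x \<in> idx d A" "y \<in> idx d A"
  proof (rule sum_eq_0_by_flip[where w = w])
    fix z assume z: "z \<in> idx d (B - A)"
    have fz: "flip {w} z \<in> idx d (B - A)"
      by (rule flip_in_idx) (use assms z in auto)
    have "override_on x (flip {w} z) (B - A) = flip {w} (override_on x z (B - A))"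
      using assms(5) by (auto simp: override_on_def flip_def fun_eq_iff)
    moreover have "override_on x z (B - A) w < 2"
      using assms(5,6) idx_less[OF z, of w] by simp
    ultimately have "phase S (override_on x (flip {w} z) (B - A)) = - phase S (override_on x z (B - A))"
      using phase_flip_single[OF assms(3,4)] by simp
    then show "pauli d B F S (override_on x (flip {w} z) (B - A)) (override_on y (flip {w} z) (B - A)) =
        - pauli d B F S (override_on x z (B - A)) (override_on y z (B - A))"
      using override_in_idx[OF assms(1) xy(1) z] override_in_idx[OF assms(1) xy(1) fz]
        override_eq_flip_iff[OF assms(2) xy]
      by (simp add: pauli_def)
  qed (use assms in auto)
  then show "partial_trace d B A (pauli d B F S) x y = 0"
    by (auto simp: partial_trace_def)
qed

text \<open>A Pauli product with disjoint \<open>F\<close> and \<open>S\<close> is Hermitian and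
  permutes the basis up to signs. Its quadratic form is therefore at most the squared norm of the
  vector in absolute value, which leaves at least the fraction \<open>1 - \<bar>r\<bar>\<close> of
  the identity term.\<close>

lemma positive_definite_pauli:
  assumes fin: "finite A" and F: "F \<subseteq> A" "\<forall>v\<in>F. d v = 2" and FS: "F \<inter> S = {}"
    and m: "0 < m" and r: "\<bar>r\<bar> < 1"
  shows "positive_definite (idx d A) (op_comb m (op_id (idx d A)) (m * r) (pauli d A F S))"
    (is "positive_definite ?I ?M")
  unfolding positive_definite_def
proof (intro conjI ballI allI impI)
  show "?M \<in> operators ?I"
    by (intro op_comb_operators op_id_operators pauli_operators F)
next
  fix x y assume xy: "x \<in> ?I" "y \<in> ?I"
  have "cnj (phase S x) = phase S x"
    by (simp add: phase_def)
  moreover have "x = flip F y \<longleftrightarrow> y = flip F x"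
    using flip_flip[OF F] xy by metis
  ultimately show "?M x y = cnj (?M y x)"
    using xy phase_flip_disjoint[OF FS]
    by (auto simp: op_comb_def op_id_def pauli_def)
next
  fix \<psi> :: "_ \<Rightarrow> complex" assume "\<exists>x\<in>?I. \<psi> x \<noteq> 0"
  then have pos: "0 < (\<Sum>x\<in>?I. (cmod (\<psi> x))\<^sup>2)"
    using finite_idx[OF fin] by (auto intro!: sum_pos2)
  have ap: "op_apply ?I (pauli d A F S) \<psi> x = phase S x * \<psi> (flip F x)" if "x \<in> ?I" for x
    using that flip_in_idx[OF F that] finite_idx[OF fin]
    by (simp add: op_apply_def pauli_def if_distrib[of "\<lambda>c. c * _"] cong: if_cong)
  have ph: "cmod (phase S x) = 1" for x
    by (simp add: phase_def prod_norm[symmetric] norm_power)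
  \<comment> \<open>This is the inequality between the product and the mean of squares. Summed over
    the basis, the flipped squares give the same norm again, since the flip is a bijection.\<close>
  have bound: "- ((cmod (\<psi> x))\<^sup>2 + (cmod (\<psi> (flip F x)))\<^sup>2) / 2 * \<bar>r\<bar> \<le>
      r * Re (cnj (\<psi> x) * (phase S x * \<psi> (flip F x)))" for x
  proof -
    have "\<bar>r * Re (cnj (\<psi> x) * (phase S x * \<psi> (flip F x)))\<bar>
        \<le> \<bar>r\<bar> * cmod (cnj (\<psi> x) * (phase S x * \<psi> (flip F x)))"
      unfolding abs_mult by (intro mult_left_mono abs_Re_le_cmod) simp
    also have "cmod (cnj (\<psi> x) * (phase S x * \<psi> (flip F x))) = cmod (\<psi> x) * cmod (\<psi> (flip F x))"
      by (simp add: norm_mult ph)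
    also have "\<bar>r\<bar> * \<dots> \<le> \<bar>r\<bar> * (((cmod (\<psi> x))\<^sup>2 + (cmod (\<psi> (flip F x)))\<^sup>2) / 2)"
      using sum_squares_bound[of "cmod (\<psi> x)" "cmod (\<psi> (flip F x))"]
      by (intro mult_left_mono) auto
    finally have "- (\<bar>r\<bar> * (((cmod (\<psi> x))\<^sup>2 + (cmod (\<psi> (flip F x)))\<^sup>2) / 2)) \<le>
        r * Re (cnj (\<psi> x) * (phase S x * \<psi> (flip F x)))"
      by linarith
    then show ?thesis
      by (simp only: minus_divide_left mult_minus_left mult.commute)
  qed
  have "(\<Sum>x\<in>?I. (cmod (\<psi> (flip F x)))\<^sup>2) = (\<Sum>x\<in>?I. (cmod (\<psi> x))\<^sup>2)"
    by (rule sum.reindex_bij_betw[OF bij_betw_flip[OF F]])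
  then have sum: "(\<Sum>x\<in>?I. - ((cmod (\<psi> x))\<^sup>2 + (cmod (\<psi> (flip F x)))\<^sup>2) / 2 * \<bar>r\<bar>)
      = - \<bar>r\<bar> * (\<Sum>x\<in>?I. (cmod (\<psi> x))\<^sup>2)"
    unfolding sum_distrib_right[symmetric] sum_divide_distrib[symmetric] sum_negf sum.distrib by simp
  have "- \<bar>r\<bar> * (\<Sum>x\<in>?I. (cmod (\<psi> x))\<^sup>2) \<le>
      (\<Sum>x\<in>?I. r * Re (cnj (\<psi> x) * (phase S x * \<psi> (flip F x))))"
    unfolding sum[symmetric] by (rule sum_mono, rule bound)
  moreover have "0 < (1 - \<bar>r\<bar>) * (\<Sum>x\<in>?I. (cmod (\<psi> x))\<^sup>2)"
    using pos r by simp
  ultimately have "0 < (\<Sum>x\<in>?I. (cmod (\<psi> x))\<^sup>2) +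
      (\<Sum>x\<in>?I. r * Re (cnj (\<psi> x) * (phase S x * \<psi> (flip F x))))"
    by (simp add: algebra_simps)
  then have "0 < m * ((\<Sum>x\<in>?I. (cmod (\<psi> x))\<^sup>2) +
      (\<Sum>x\<in>?I. r * Re (cnj (\<psi> x) * (phase S x * \<psi> (flip F x)))))"
    using m by simp
  also have "\<dots> = (\<Sum>x\<in>?I. m * ((cmod (\<psi> x))\<^sup>2 + r * Re (cnj (\<psi> x) * (phase S x * \<psi> (flip F x)))))"
    by (simp only: sum.distrib sum_distrib_left distrib_left)
  also have "\<dots> = (\<Sum>x\<in>?I. Re (cnj (\<psi> x) * op_apply ?I ?M \<psi> x))"
  proof (rule sum.cong)
    fix x assume x: "x \<in> ?I"
    have "Re (cnj (\<psi> x) * \<psi> x) = (cmod (\<psi> x))\<^sup>2"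
      unfolding cmod_power2 by (simp add: power2_eq_square)
    moreover have "cnj (\<psi> x) * op_apply ?I ?M \<psi> x = complex_of_real m * (cnj (\<psi> x) * \<psi> x)
        + complex_of_real (m * r) * (cnj (\<psi> x) * (phase S x * \<psi> (flip F x)))"
      unfolding op_apply_comb ap[OF x] op_apply_id[OF finite_idx[OF fin] x]
      by (simp add: algebra_simps)
    moreover have "Re (complex_of_real c * w) = c * Re w" for c w
      by simp
    ultimately show "m * ((cmod (\<psi> x))\<^sup>2 + r * Re (cnj (\<psi> x) * (phase S x * \<psi> (flip F x)))) =
        Re (cnj (\<psi> x) * op_apply ?I ?M \<psi> x)"
      by (simp only: plus_complex.sel distrib_left mult.assoc)
  qed simp
  finally show "0 < Re (\<Sum>x\<in>?I. cnj (\<psi> x) * op_apply ?I ?M \<psi> x)"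
    by (simp only: Re_sum)
qed

section \<open>The state of an induced chain\<close>

text \<open>The absolute value covers all real \<open>p\<close> at once: \<open>sqrt\<close> is an
  odd function, so \<open>sqrt p * sqrt p = \<bar>p\<bar>\<close> also for negative
  \<open>p\<close>.\<close>

lemma op_star_scalar:
  assumes "finite I" and "M \<in> operators I"
  shows "op_star I M (op_comb p (op_id I) 0 L) = op_comb \<bar>p\<bar> M 0 M"
proof -
  have "op_comb p (op_id I) 0 L = op_comb p (op_id I) (p * 0) (op_id I)"
    by (simp add: op_comb_def)
  then have root: "op_fun I sqrt (op_comb p (op_id I) 0 L) = op_comb (sqrt p) (op_id I) 0 (op_id I)"
    using op_fun_involution[OF assms(1) op_id_operators op_mult_id_left[OF assms(1) op_id_operators],
        of sqrt p 0] by simp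
  show ?thesis
    unfolding op_star_def root op_mult_comb_left op_mult_comb_right
    using assms by (simp add: op_mult_id_left op_mult_id_right)
      (simp add: op_comb_def fun_eq_iff flip: of_real_mult mult.assoc)
qed

lemma op_star_id:
  assumes "finite I" and "M \<in> operators I" and "op_mult I (op_fun I sqrt M) (op_fun I sqrt M) = M"
    and "op_fun I sqrt M \<in> operators I"
  shows "op_star I (op_id I) M = M"
  using assms by (simp add: op_star_def op_mult_id_right)

section \<open>The numerical entropy inequality\<close>

lemma bias_deficit_0 [simp]: "bias_deficit 0 = 0"
  by (simp add: bias_deficit_def)

lemma bias_deficit_strict: "bias_deficit (3/5) + bias_deficit (9/20) < bias_deficit (3/4)"
proof -
  \<comment> \<open>Multiplying by 40 makes all the weights integers, for instance
    \<open>40 * (1 + 3/5) / 2 = 32\<close>. The claim then compares logarithms of two rational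
    numbers, which is decided by evaluation.\<close>
  have "32 * ln (8/5) + 8 * ln (2/5) + 29 * ln (29/20) + 11 * ln (11/20)
      = ln ((8/5) ^ 32 * (2/5) ^ 8 * (29/20) ^ 29 * (11/20) ^ 11 :: real)"
    by (simp add: ln_mult_pos ln_realpow)
  also have "\<dots> < ln ((7/4) ^ 35 * (1/4) ^ 5 :: real)"
    by (subst ln_less_cancel_iff) (simp_all add: power_divide)
  also have "\<dots> = 35 * ln (7/4) + 5 * ln (1/4)"
    by (simp add: ln_mult_pos ln_realpow)
  finally have less: "32 * ln (8/5) + 8 * ln (2/5) + 29 * ln (29/20) + 11 * ln (11/20)
      < 35 * ln (7/4) + 5 * ln (1/4 :: real)" .
  have "bias_deficit (3/5) = (32 * ln (8/5) + 8 * ln (2/5)) / 40"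
    and "bias_deficit (9/20) = (29 * ln (29/20) + 11 * ln (11/20)) / 40"
    and "bias_deficit (3/4) = (35 * ln (7/4) + 5 * ln (1/4)) / 40"
    by (simp_all add: bias_deficit_def field_simps)
  with less show ?thesis
    by (simp only: add_divide_distrib[symmetric] add.assoc divide_less_cancel) simp
qed

locale induced_chain =
  fixes V :: "'v set" and E :: "('v \<times> 'v) set" and i j k :: 'v
  assumes dag: "dag V E" and ij: "(i, j) \<in> E" and jk: "(j, k) \<in> E" and ik: "(i, k) \<notin> E"
begin

lemma finite_V: "finite V"
  using dag by (simp add: dag_def)

lemma edge_in_V: "(u, v) \<in> E \<Longrightarrow> u \<in> V \<and> v \<in> V"
  using dag by (auto simp: dag_def)

lemma not_path_cycle: "(u, u) \<notin> E\<^sup>+"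
  using dag by (simp add: dag_def acyclic_def)

lemma no_edges: "(j, i) \<notin> E" "(k, j) \<notin> E" "(k, i) \<notin> E" "(v, v) \<notin> E"
  using not_path_cycle ij jk by (meson trancl.simps)+

lemma distinct_chain: "i \<noteq> j" "j \<noteq> k" "i \<noteq> k"
  using no_edges ij jk by auto

section \<open>Pauli operators on the chain\<close>

definition d :: "'v \<Rightarrow> nat" where
  "d v = (if v \<in> {i, j, k} then 2 else 1)"

lemma d_simps [simp]: "d i = 2" "d j = 2" "d k = 2" "0 < d v"
  by (simp_all add: d_def)

definition dimension :: "'v set \<Rightarrow> nat" where
  "dimension A = (\<Prod>v\<in>A. d v)"

lemma dimension_pos: "0 < dimension A"
  by (simp add: dimension_def prod_pos)

lemma card_idx_d: "finite A \<Longrightarrow> card (idx d A) = dimension A"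
  by (simp add: card_idx dimension_def)

abbreviation ZZ :: "'v set \<Rightarrow> ('v \<Rightarrow> nat) cmatrix" where
  "ZZ A \<equiv> pauli d A {} {i, j}"

abbreviation XZ :: "'v set \<Rightarrow> ('v \<Rightarrow> nat) cmatrix" where
  "XZ A \<equiv> pauli d A {j} {k}"

text \<open>The scale \<open>p\<close> is a common factor, so the bias
  \<open>sqrt (b\<^sup>2 + s\<^sup>2)\<close> depends on \<open>b\<close> and \<open>s\<close>
  alone.\<close>

definition pauli_sum :: "real \<Rightarrow> real \<Rightarrow> real \<Rightarrow> 'v set \<Rightarrow> ('v \<Rightarrow> nat) cmatrix" where
  "pauli_sum p b s A = op_comb p (op_id (idx d A)) p (op_comb b (ZZ A) s (XZ A))"

text \<open>The flip at \<open>j\<close> meets exactly one \<open>Z\<close> of the other product and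
  reverses the phase of \<open>{i, j}\<close>.\<close>

lemma XZ_ZZ_anticommute:
  assumes "finite A" and "j \<in> A"
  shows "op_mult (idx d A) (XZ A) (ZZ A) x y = - op_mult (idx d A) (ZZ A) (XZ A) x y"
proof (cases "x \<in> idx d A")
  case True
  have "flip {j} x \<in> idx d A"
    by (rule flip_in_idx) (use assms True in auto)
  moreover have "phase {i, j} (flip {j} x) = - phase {i, j} x"
    by (rule phase_flip_single) (use idx_less[OF True assms(2)] in auto)
  ultimately show ?thesis
    using True assms by (subst (1 2) op_mult_pauli) (auto simp: pauli_def)
qed (use assms in \<open>simp add: op_mult_pauli\<close>)

text \<open>An index has the value \<open>undefined\<close> outside \<open>A\<close>, so a vertex of
  \<open>{i, j}\<close> missing from \<open>A\<close> contributes a constant sign and the square is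
  still the identity.\<close>

lemma ZZ_involution: "finite A \<Longrightarrow> op_mult (idx d A) (ZZ A) (ZZ A) = op_id (idx d A)"
  by (rule pauli_involution) auto

lemma XZ_involution:
  "finite A \<Longrightarrow> j \<in> A \<Longrightarrow> op_mult (idx d A) (XZ A) (XZ A) = op_id (idx d A)"
  by (rule pauli_involution) (use distinct_chain in auto)

text \<open>Exchanging the first two factors costs a sign, and then the two copies of
  \<open>ZZ\<close> cancel.\<close>

lemma ZZ_XZ_ZZ:
  assumes "finite A" and "j \<in> A"
  shows "op_mult (idx d A) (op_mult (idx d A) (ZZ A) (XZ A)) (ZZ A) = op_comb (-1) (XZ A) 0 (XZ A)"
proof (intro ext)
  fix x y
  let ?I = "idx d A"
  have "op_mult ?I (op_mult ?I (ZZ A) (XZ A)) (ZZ A) x y =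
      (\<Sum>z\<in>?I. op_mult ?I (ZZ A) (XZ A) x z * ZZ A z y)"
    by (simp add: op_mult_def)
  also have "\<dots> = (\<Sum>z\<in>?I. - (op_mult ?I (XZ A) (ZZ A) x z * ZZ A z y))"
    using assms by (simp add: XZ_ZZ_anticommute)
  also have "\<dots> = - op_mult ?I (op_mult ?I (XZ A) (ZZ A)) (ZZ A) x y"
    by (simp add: op_mult_def sum_negf)
  also have "op_mult ?I (op_mult ?I (XZ A) (ZZ A)) (ZZ A) = op_mult ?I (XZ A) (op_mult ?I (ZZ A) (ZZ A))"
    by (rule op_mult_assoc)
  also have "op_mult ?I (XZ A) (op_mult ?I (ZZ A) (ZZ A)) = XZ A"
    using assms by (simp add: ZZ_involution op_mult_id_right finite_idx pauli_operators)
  finally show "op_mult ?I (op_mult ?I (ZZ A) (XZ A)) (ZZ A) x y = op_comb (-1) (XZ A) 0 (XZ A) x y"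
    by (simp add: op_comb_def)
qed

text \<open>\<open>K\<close> is \<open>(b ZZ + s XZ) / r\<close>, whose square is the identity because \<open>ZZ\<close> and \<open>XZ\<close> anticommute.\<close>

lemma pauli_sum_spectral:
  assumes fin: "finite A" and b: "b \<noteq> 0 \<Longrightarrow> {i, j} \<subseteq> A" and s: "s \<noteq> 0 \<Longrightarrow> {j, k} \<subseteq> A"
  defines "r \<equiv> sqrt (b\<^sup>2 + s\<^sup>2)"
  obtains K where "K \<in> operators (idx d A)" and "op_mult (idx d A) K K = op_id (idx d A)"
    and "\<And>p. pauli_sum p b s A = op_comb p (op_id (idx d A)) (p * r) K"
    and "r \<noteq> 0 \<Longrightarrow> op_trace (idx d A) K = 0"
proof (cases "r = 0")
  case True
  then have "b = 0" "s = 0"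
    by (auto simp: r_def add_nonneg_eq_0_iff)
  then have "pauli_sum p b s A = op_comb p (op_id (idx d A)) (p * r) (op_id (idx d A))" for p
    using True by (simp add: pauli_sum_def op_comb_def)
  then show ?thesis
    using that[of "op_id (idx d A)"] True fin by (simp add: op_id_operators op_mult_id_left finite_idx)
next
  case False
  let ?I = "idx d A"
  \<comment> \<open>For \<open>s = 0\<close> it is not known that \<open>j\<close> lies in
    \<open>A\<close>, and then \<open>XZ A\<close> might not be an operator on this space; zero
    takes its place.\<close>
  define X where "X = (if s = 0 then (\<lambda>_ _. 0) else XZ A)"
  define K where "K = op_comb (b / r) (ZZ A) (s / r) X"
  have rr: "r * r = b * b + s * s"
    by (simp add: r_def power2_eq_square)
  have "(b / r) * (b / r) + (s / r) * (s / r) = (b * b + s * s) / (r * r)"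
    by (simp add: add_divide_distrib)
  then have one: "(b / r) * (b / r) + (s / r) * (s / r) = 1"
    unfolding rr[symmetric] using False by simp
  have X: "X \<in> operators ?I"
    using s by (auto simp: X_def operators_def[of "{}"] intro!: pauli_operators) (simp add: operators_def)
  have "op_mult ?I K K = op_id ?I"
  proof (cases "s = 0")
    case True
    then have "b \<noteq> 0"
      using rr False by auto
    with True show ?thesis
      unfolding K_def op_mult_comb_left op_mult_comb_right ZZ_involution[OF fin]
      using one by (simp add: op_comb_def fun_eq_iff flip: mult.assoc of_real_mult)
  next
    case False
    then have j: "j \<in> A" using s by auto
    show ?thesis
    proof (intro ext)
      fix x y
      \<comment> \<open>The squares contribute the identity with total weight 1, and the cross terms
        cancel by anticommutation.\<close>
      have "op_mult ?I K K x y = complex_of_real (b / r * (b / r) + s / r * (s / r)) * op_id ?I x y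
          + complex_of_real (b / r * (s / r)) * (op_mult ?I (ZZ A) (XZ A) x y + op_mult ?I (XZ A) (ZZ A) x y)"
        unfolding K_def op_mult_comb_left op_mult_comb_right using False fin j
        by (simp add: X_def ZZ_involution XZ_involution)
          (simp add: op_comb_def algebra_simps add_divide_distrib)
      then show "op_mult ?I K K x y = op_id ?I x y"
        unfolding one using XZ_ZZ_anticommute[OF fin j] by simp
    qed
  qed
  moreover have "pauli_sum p b s A = op_comb p (op_id ?I) (p * r) K" for p
    using False by (auto simp: pauli_sum_def op_comb_def K_def X_def fun_eq_iff field_simps)
  moreover have "op_trace ?I K = 0"
  proof -
    have "op_trace ?I (ZZ A) = 0" if "b \<noteq> 0"
      by (rule op_trace_pauli_phase[where w = i]) (use b[OF that] in auto)
    moreover have "op_trace ?I X = 0" if "s \<noteq> 0"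
      using that s op_trace_pauli_flip[of j "{j}" A d "{k}"] by (simp add: X_def)
    ultimately show ?thesis
      by (cases "b = 0"; cases "s = 0") (simp_all add: K_def op_trace_comb)
  qed
  moreover have "K \<in> operators ?I"
    unfolding K_def by (intro op_comb_operators X pauli_operators) auto
  ultimately show ?thesis
    using that by blast
qed

lemma pauli_sum_scalar: "pauli_sum p 0 0 A = op_comb p (op_id (idx d A)) 0 L"
  by (simp add: pauli_sum_def op_comb_def)

lemma embed_pauli_sum:
  assumes "A \<subseteq> B" and "b \<noteq> 0 \<Longrightarrow> {i, j} \<subseteq> A" and "s \<noteq> 0 \<Longrightarrow> {j, k} \<subseteq> A"
  shows "embed d A B (pauli_sum p b s A) = pauli_sum p b s B"
  unfolding pauli_sum_def embed_comb op_id_eq_pauli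
  by (intro op_comb_cong embed_pauli) (use assms in auto)

text \<open>A Pauli product survives exactly when its vertices remain. The assumption on
  \<open>s\<close> keeps the flipped vertex \<open>j\<close> in \<open>A\<close>, so that only a
  \<open>Z\<close> is ever traced out.\<close>

lemma partial_trace_pauli_sum:
  assumes fin: "finite B" and AB: "A \<subseteq> B"
    and b: "b \<noteq> 0 \<Longrightarrow> {i, j} \<subseteq> B" and s: "s \<noteq> 0 \<Longrightarrow> j \<in> A \<and> k \<in> B"
  shows "partial_trace d B A (pauli_sum p b s B) =
    pauli_sum (p * dimension (B - A)) (if {i, j} \<subseteq> A then b else 0) (if {j, k} \<subseteq> A then s else 0) A"
proof (intro ext)
  fix x y
  have c: "card (idx d (B - A)) = dimension (B - A)"
    using fin by (simp add: card_idx_d)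
  have 1: "partial_trace d B A (op_id (idx d B)) x y = of_nat (dimension (B - A)) * op_id (idx d A) x y"
    unfolding op_id_eq_pauli using partial_trace_pauli[OF fin AB, of "{}" "{}" d]
    by (simp add: c op_comb_def)
  have 2: "complex_of_real b * partial_trace d B A (ZZ B) x y =
      of_nat (dimension (B - A)) * complex_of_real (if {i, j} \<subseteq> A then b else 0) * ZZ A x y"
  proof -
    consider "b = 0" | "{i, j} \<subseteq> A" | w where "w \<in> {i, j}" "w \<in> B - A" "b \<noteq> 0" using b by blast
    then show ?thesis
    proof cases
      case 2
      then show ?thesis
        using partial_trace_pauli[OF fin AB, of "{}" "{i, j}" d] by (simp add: c op_comb_def)
    next
      case 3
      then have "partial_trace d B A (ZZ B) = (\<lambda>_ _. 0)"
        by (intro partial_trace_pauli_eq_0[OF AB, where w = w]) auto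
      with 3 show ?thesis by auto
    qed simp
  qed
  have 3: "complex_of_real s * partial_trace d B A (XZ B) x y =
      of_nat (dimension (B - A)) * complex_of_real (if {j, k} \<subseteq> A then s else 0) * XZ A x y"
  proof -
    consider "s = 0" | "{j, k} \<subseteq> A" | "j \<in> A" "k \<in> B - A" using s by blast
    then show ?thesis
    proof cases
      case 2
      then show ?thesis
        using partial_trace_pauli[OF fin AB, of "{j}" "{k}" d] by (simp add: c op_comb_def)
    next
      case 3
      then have "partial_trace d B A (XZ B) = (\<lambda>_ _. 0)"
        by (intro partial_trace_pauli_eq_0[OF AB, where w = k]) auto
      with 3 show ?thesis by auto
    qed simp
  qed
  have "partial_trace d B A (pauli_sum p b s B) x y = complex_of_real p *
      partial_trace d B A (op_id (idx d B)) x y + complex_of_real p * (complex_of_real b *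
      partial_trace d B A (ZZ B) x y + complex_of_real s * partial_trace d B A (XZ B) x y)"
    unfolding pauli_sum_def partial_trace_comb by (simp add: op_comb_def)
  then show "partial_trace d B A (pauli_sum p b s B) x y =
    pauli_sum (p * dimension (B - A)) (if {i, j} \<subseteq> A then b else 0) (if {j, k} \<subseteq> A then s else 0) A x y"
    unfolding 1 2 3 by (simp add: pauli_sum_def op_comb_def algebra_simps)
qed

text \<open>
  As \<open>XZ\<close> anticommutes with \<open>ZZ\<close>, multiplying it on both sides by \<open>(I + 3/5 ZZ)\<^sup>1\<^sup>/\<^sup>2\<close> scales it by
  \<open>(1 - (3/5)\<^sup>2)\<^sup>1\<^sup>/\<^sup>2 = 4/5\<close>. So \<open>9/16\<close> in the kernel becomes \<open>9/20\<close> in the state.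
\<close>

definition kernel :: "'v \<Rightarrow> ('v \<Rightarrow> nat) cmatrix" where
  "kernel v = pauli_sum (1 / d v) (if v = j then 3/5 else 0) (if v = k then 9/16 else 0)
     (insert v (pa E v))"

text \<open>Defining it for every \<open>A\<close> gives a closed form for the state after each
  initial segment of an ordering, as the induction along the ordering requires.\<close>

definition state :: "'v set \<Rightarrow> ('v \<Rightarrow> nat) cmatrix" where
  "state A = pauli_sum (1 / dimension A) (if {i, j} \<subseteq> A then 3/5 else 0)
     (if {j, k} \<subseteq> A then 9/20 else 0) A"

section \<open>The kernels and one step of the ordered construction\<close>

lemma finite_pa: "finite (pa E v)"
  using finite_V edge_in_V by (auto simp: pa_def intro: finite_subset)

lemma kernel_family_kernel: "kernel_family V E d kernel"
  unfolding kernel_family_def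
proof (intro ballI conjI)
  fix v
  let ?A = "insert v (pa E v)"
  have fin: "finite ?A"
    using finite_pa by simp
  consider "v = j" | "v = k" | "v \<noteq> j" "v \<noteq> k" by blast
  then show "positive_definite (idx d ?A) (kernel v)"
  proof cases
    case 1
    then have "kernel v = op_comb (1/2) (op_id (idx d ?A)) (1/2 * (3/5)) (ZZ ?A)"
      using distinct_chain by (simp add: kernel_def pauli_sum_def op_comb_def)
    then show ?thesis
      using positive_definite_pauli[OF fin, of "{}" d "{i, j}" "1/2" "3/5"] by simp
  next
    case 2
    then have "kernel v = op_comb (1/2) (op_id (idx d ?A)) (1/2 * (9/16)) (XZ ?A)"
      using distinct_chain by (simp add: kernel_def pauli_sum_def op_comb_def)
    then show ?thesis
      using positive_definite_pauli[OF fin, of "{j}" d "{k}" "1/2" "9/16"] 2 jk distinct_chain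
      by (simp add: pa_def)
  next
    case 3
    then have "kernel v = op_comb (1 / d v) (op_id (idx d ?A)) (1 / d v * 0) (pauli d ?A {} {})"
      by (simp add: kernel_def pauli_sum_def op_comb_def)
    then show ?thesis
      using positive_definite_pauli[OF fin, of "{}" d "{}" "1 / d v" 0] by simp
  qed
  have v: "v \<notin> pa E v"
    using no_edges by (simp add: pa_def)
  then have "?A - pa E v = {v}"
    by auto
  then have dim: "1 / d v * dimension (?A - pa E v) = 1"
    using d_simps(4)[of v] by (simp add: dimension_def)
  have "partial_trace d ?A (pa E v) (kernel v) =
      pauli_sum (1 / d v * dimension (?A - pa E v))
        (if {i, j} \<subseteq> pa E v then if v = j then 3/5 else 0 else 0)
        (if {j, k} \<subseteq> pa E v then if v = k then 9/16 else 0 else 0) (pa E v)"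
    unfolding kernel_def
    by (rule partial_trace_pauli_sum[OF fin]) (use ij jk in \<open>auto simp: pa_def split: if_splits\<close>)
  \<comment> \<open>Each Pauli term involves the vertex \<open>v\<close> of its own kernel, and
    \<open>v\<close> is not among its parents, so neither term survives.\<close>
  also have "\<dots> = pauli_sum 1 0 0 (pa E v)"
    unfolding dim using v by auto
  finally show "partial_trace d ?A (pa E v) (kernel v) = op_id (idx d (pa E v))"
    by (simp add: pauli_sum_def op_comb_def)
qed

lemma pauli_sum_operators:
  assumes "finite A" and "b \<noteq> 0 \<Longrightarrow> {i, j} \<subseteq> A" and "s \<noteq> 0 \<Longrightarrow> {j, k} \<subseteq> A"
  shows "pauli_sum p b s A \<in> operators (idx d A)"
proof -
  obtain K where "K \<in> operators (idx d A)"
    and eq: "\<And>p. pauli_sum p b s A = op_comb p (op_id (idx d A)) (p * sqrt (b\<^sup>2 + s\<^sup>2)) K"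
    using pauli_sum_spectral[OF assms] by blast
  then show ?thesis
    unfolding eq by (intro op_comb_operators op_id_operators)
qed

text \<open>Closure of \<open>U\<close> under parents forces the chain to appear in the order
  \<open>i\<close>, \<open>j\<close>, \<open>k\<close>. Outside the chain the kernel is the
  identity; at \<open>i\<close> and \<open>j\<close> the earlier state is scalar; only at
  \<open>k\<close> do noncommuting factors meet.\<close>

lemma star_step:
  assumes fin: "finite U" and v: "v \<notin> U" "pa E v \<subseteq> U" and down: "\<And>u. u \<in> U \<Longrightarrow> pa E u \<subseteq> U"
  defines "W \<equiv> insert v U"
  shows "op_star (idx d W) (embed d (insert v (pa E v)) W (kernel v)) (embed d U W (state U)) = state W"
proof -
  let ?I = "idx d W"
  have I: "finite ?I" and W: "finite W"
    using fin by (simp_all add: W_def finite_idx)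
  define p where "p = 1 / real (dimension U)"
  have p: "0 < p"
    using dimension_pos by (simp add: p_def)
  have dimW: "1 / real (dimension W) = 1 / d v * p"
    using fin v by (simp add: W_def dimension_def p_def)
  have kern: "embed d (insert v (pa E v)) W (kernel v) =
      pauli_sum (1 / d v) (if v = j then 3/5 else 0) (if v = k then 9/16 else 0) W"
    unfolding kernel_def
    by (rule embed_pauli_sum) (use v ij jk in \<open>auto simp: W_def pa_def split: if_splits\<close>)
  have st: "embed d U W (state U) =
      pauli_sum p (if {i, j} \<subseteq> U then 3/5 else 0) (if {j, k} \<subseteq> U then 9/20 else 0) W"
    unfolding state_def p_def by (rule embed_pauli_sum) (auto simp: W_def split: if_splits)
  have U: "j \<in> U \<Longrightarrow> i \<in> U" "k \<in> U \<Longrightarrow> j \<in> U"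
    using down[of j] down[of k] ij jk by (auto simp: pa_def)
  consider "v \<notin> {i, j, k}" | "v \<in> {i, j}" | "v = k" by blast
  then show ?thesis
  proof cases
    case 1
    then have "d v = 1" by (simp add: d_def)
    then have kid: "embed d (insert v (pa E v)) W (kernel v) = op_id ?I"
      using 1 unfolding kern by (simp add: pauli_sum_def op_comb_def)
    have stW: "embed d U W (state U) = state W"
    proof -
      have "{i, j} \<subseteq> W \<longleftrightarrow> {i, j} \<subseteq> U" "{j, k} \<subseteq> W \<longleftrightarrow> {j, k} \<subseteq> U"
        using 1 by (auto simp: W_def)
      then show ?thesis
        unfolding st unfolding state_def dimW \<open>d v = 1\<close> by simp
    qed
    obtain K where K: "K \<in> operators ?I" "op_mult ?I K K = op_id ?I"
      and eq: "\<And>p. pauli_sum p (if {i, j} \<subseteq> W then 3/5 else 0) (if {j, k} \<subseteq> W then 9/20 else 0) W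
        = op_comb p (op_id ?I) (p * sqrt
            ((if {i, j} \<subseteq> W then 3/5 else 0)\<^sup>2 + (if {j, k} \<subseteq> W then 9/20 else 0)\<^sup>2)) K"
      by (rule pauli_sum_spectral[OF W, of "if {i, j} \<subseteq> W then 3/5 else 0" "if {j, k} \<subseteq> W then 9/20 else 0"])
        (auto split: if_splits)
    have "sqrt ((if {i, j} \<subseteq> W then 3/5 else 0)\<^sup>2 + (if {j, k} \<subseteq> W then 9/20 else 0)\<^sup>2) \<le> sqrt (1\<^sup>2)"
      by (rule real_sqrt_le_mono) (auto simp: power2_eq_square)
    then have r: "\<bar>sqrt ((if {i, j} \<subseteq> W then 3/5 else 0)\<^sup>2 + (if {j, k} \<subseteq> W then 9/20 else 0)\<^sup>2)\<bar> \<le> 1"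
      by simp
    have "op_mult ?I (op_fun ?I sqrt (state W)) (op_fun ?I sqrt (state W)) = state W"
      unfolding state_def eq by (rule sqrt_involution_squared[OF I K _ r]) simp
    moreover have "op_fun ?I sqrt (state W) \<in> operators ?I"
      unfolding state_def eq op_fun_involution[OF I K] by (intro op_comb_operators op_id_operators K)
    moreover have "state W \<in> operators ?I"
      unfolding state_def by (rule pauli_sum_operators[OF W]) (auto split: if_splits)
    ultimately show ?thesis
      unfolding kid stW by (intro op_star_id I)
  next
    case 2
    \<comment> \<open>If \<open>v = i\<close>, then \<open>j\<close> in \<open>U\<close> would bring
      its parent \<open>i\<close> into \<open>U\<close>. In both cases \<open>k\<close> in
      \<open>U\<close> would bring in \<open>j\<close>.\<close>
    then have nU: "j \<notin> U" "k \<notin> U" "v \<noteq> k" and dv: "d v = 2"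
      using U v distinct_chain by auto
    have iW: "{i, j} \<subseteq> W \<longleftrightarrow> v = j"
      using 2 nU v ij distinct_chain by (auto simp: W_def pa_def)
    have kW: "\<not> {j, k} \<subseteq> W"
      using nU by (auto simp: W_def)
    have kern': "embed d (insert v (pa E v)) W (kernel v) = pauli_sum (1/2) (if v = j then 3/5 else 0) 0 W"
      using nU dv unfolding kern by simp
    have "pauli_sum (1/2) (if v = j then 3/5 else 0) 0 W \<in> operators ?I"
      by (rule pauli_sum_operators[OF W]) (use iW in \<open>auto split: if_splits\<close>)
    then have "op_star ?I (embed d (insert v (pa E v)) W (kernel v)) (embed d U W (state U)) =
        op_comb p (pauli_sum (1/2) (if v = j then 3/5 else 0) 0 W) 0
          (pauli_sum (1/2) (if v = j then 3/5 else 0) 0 W)"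
      using nU p unfolding kern' st pauli_sum_scalar
      by (simp add: pauli_sum_scalar[of _ _ "ZZ W"] op_star_scalar[OF I])
    also have "\<dots> = state W"
      unfolding state_def dimW iW dv if_not_P[OF kW]
      by (simp add: pauli_sum_def op_comb_def fun_eq_iff algebra_simps)
    finally show ?thesis .
  next
    case 3
    then have U': "i \<in> U" "j \<in> U" "k \<notin> U"
      using v jk U by (auto simp: pa_def)
    then have jW: "j \<in> W" by (simp add: W_def)
    \<comment> \<open>The earlier state has the spectral values \<open>p * (8/5)\<close> and
      \<open>p * (2/5)\<close>. Their ratio is 4, so the roots are \<open>2 * t\<close> and
      \<open>t\<close>, with half sum \<open>3/2 * t\<close> and half difference
      \<open>t/2\<close>.\<close>
    define t where "t = sqrt (p * (2/5))"
    have tt: "t * t = p * (2/5)"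
      using p by (simp add: t_def)
    have "sqrt (p * (1 + 3/5)) = sqrt (4 * (p * (2/5)))"
      by simp
    then have t2: "sqrt (p * (1 + 3/5)) = 2 * t"
      unfolding t_def real_sqrt_mult by simp
    have t1: "sqrt (p * (1 - 3/5)) = t"
      by (simp add: t_def)
    have "embed d U W (state U) = op_comb p (op_id ?I) (p * (3/5)) (ZZ W)"
      using U' unfolding st by (simp add: pauli_sum_def op_comb_def mult.assoc)
    moreover have "ZZ W \<in> operators ?I"
      by (rule pauli_operators) auto
    ultimately have root: "op_fun ?I sqrt (embed d U W (state U)) = op_comb (3/2 * t) (op_id ?I) (t/2) (ZZ W)"
      using op_fun_involution[OF I _ ZZ_involution[OF W], of sqrt p "3/5"] unfolding t1 t2 by simp
    have kern': "embed d (insert v (pa E v)) W (kernel v) = op_comb (1/2) (op_id ?I) (9/32) (XZ W)"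
      using 3 distinct_chain unfolding kern by (simp add: pauli_sum_def op_comb_def)
    have ops: "ZZ W \<in> operators ?I" "XZ W \<in> operators ?I"
      using jW by (auto intro!: pauli_operators)
    have opsX: "op_mult ?I (ZZ W) (XZ W) \<in> operators ?I"
      using ops by (auto simp: operators_def op_mult_def)
    show ?thesis
    proof (intro ext)
      fix x y
      \<comment> \<open>The sign in \<open>ZZ_XZ_ZZ\<close> turns the weight of \<open>XZ\<close>
        into \<open>9/32 * ((3/2)^2 - (1/2)^2) = 9/16\<close>. The last bracket is zero by
        anticommutation.\<close>
      have "op_star ?I (embed d (insert v (pa E v)) W (kernel v)) (embed d U W (state U)) x y =
        complex_of_real (t * t * (5/4)) * op_id ?I x y + complex_of_real (t * t * (3/4)) * ZZ W x y
        + complex_of_real (t * t * (9/16)) * XZ W x y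
        + complex_of_real (t * t * (27/128)) * (op_mult ?I (ZZ W) (XZ W) x y + op_mult ?I (XZ W) (ZZ W) x y)"
        unfolding op_star_def root kern' op_mult_comb_left op_mult_comb_right
        using W jW by (simp add: op_mult_id_left op_mult_id_right I op_id_operators ops opsX
            ZZ_XZ_ZZ ZZ_involution) (simp add: op_comb_def algebra_simps)
      also have "\<dots> = state W x y"
        unfolding tt XZ_ZZ_anticommute[OF W jW] state_def dimW
        using 3 U' by (simp add: W_def pauli_sum_def op_comb_def algebra_simps)
      finally show "op_star ?I (embed d (insert v (pa E v)) W (kernel v)) (embed d U W (state U)) x y = state W x y" .
    qed
  qed
qed

section \<open>Topological orderings and order invariance\<close>

lemma topological_pa:
  assumes "topological_ordering V E vs" and "l < length vs"
  shows "pa E (vs ! l) \<subseteq> set (take l vs)"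
proof
  fix u assume u: "u \<in> pa E (vs ! l)"
  then have "u \<in> set vs"
    using assms(1) edge_in_V by (auto simp: pa_def topological_ordering_def)
  then obtain m where m: "m < length vs" "vs ! m = u"
    by (auto simp: in_set_conv_nth)
  then have "m < l"
    using assms u by (auto simp: pa_def topological_ordering_def)
  then show "u \<in> set (take l vs)"
    using m assms(2) by (auto simp: in_set_conv_nth intro!: exI[of _ m])
qed

lemma take_down_closed:
  assumes "topological_ordering V E vs" and "u \<in> set (take l vs)"
  shows "pa E u \<subseteq> set (take l vs)"
proof -
  obtain m where m: "m < length vs" "m < l" "u = vs ! m"
    using assms(2) by (auto simp: in_set_conv_nth)
  then show ?thesis
    using topological_pa[OF assms(1) m(1)] set_take_subset_set_take[of m l vs] by auto
qed

lemma partial_state_eq_state: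
  assumes top: "topological_ordering V E vs" and "Suc m \<le> length vs"
  shows "partial_state E d kernel vs (Suc m) = state (set (take (Suc m) vs))"
  using assms(2)
proof (induction m)
  case 0
  then have "0 < length vs"
    by linarith
  \<comment> \<open>The first vertex has no parents, so it is neither \<open>j\<close> nor
    \<open>k\<close> and its kernel is a multiple of the identity.\<close>
  from topological_pa[OF top this] have pa0: "pa E (vs ! 0) = {}"
    by simp
  then have "vs ! 0 \<noteq> j" "vs ! 0 \<noteq> k"
    using ij jk by (auto simp: pa_def)
  moreover have "set (take (Suc 0) vs) = {vs ! 0}"
    using 0 by (cases vs) auto
  ultimately show ?case
    using pa0 distinct_chain by (auto simp: kernel_def state_def dimension_def)
next
  case (Suc m)
  define U where "U = set (take (Suc m) vs)"
  have tk: "set (take (Suc (Suc m)) vs) = insert (vs ! Suc m) U"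
    using Suc.prems by (simp add: take_Suc_conv_app_nth[of "Suc m"] U_def)
  have "vs ! Suc m \<notin> U"
    using Suc.prems top by (auto simp: U_def topological_ordering_def in_set_conv_nth nth_eq_iff_index_eq)
  moreover have "pa E (vs ! Suc m) \<subseteq> U"
    using topological_pa[OF top, of "Suc m"] Suc.prems by (simp add: U_def)
  moreover have "finite U"
    by (simp add: U_def)
  moreover have "pa E u \<subseteq> U" if "u \<in> U" for u
    using take_down_closed[OF top] that by (auto simp: U_def)
  ultimately have "op_star (idx d (insert (vs ! Suc m) U))
      (embed d (insert (vs ! Suc m) (pa E (vs ! Suc m))) (insert (vs ! Suc m) U) (kernel (vs ! Suc m)))
      (embed d U (insert (vs ! Suc m) U) (state U)) = state (insert (vs ! Suc m) U)"
    by (intro star_step)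
  moreover have "partial_state E d kernel vs (Suc m) = state U"
    using Suc by (simp add: U_def)
  ultimately show ?case
    unfolding partial_state.simps(3) Let_def tk U_def[symmetric] by simp
qed

lemma ordered_state_eq_state:
  assumes "topological_ordering V E vs"
  shows "ordered_state E d kernel vs = state V"
proof -
  have "set vs = V"
    using assms by (simp add: topological_ordering_def)
  then obtain m where m: "length vs = Suc m"
    using edge_in_V[OF ij] by (cases vs) auto
  then show ?thesis
    using partial_state_eq_state[OF assms, of m] \<open>set vs = V\<close> by (simp add: ordered_state_def)
qed

lemma order_invariant_kernel: "order_invariant V E d kernel"
  by (simp add: order_invariant_def ordered_state_eq_state)

text \<open>The given ordering yields uniqueness: with no ordering at all, every operator would
  satisfy the description vacuously.\<close>

lemma common_state_kernel:
  assumes "topological_ordering V E vs"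
  shows "common_state V E d kernel = state V"
  unfolding common_state_def
  by (rule the_equality) (use assms ordered_state_eq_state in auto)

section \<open>Entropies of marginals and failure of the Markov property\<close>

lemma entropy_state:
  assumes "A \<subseteq> V" and "j \<in> A"
  shows "entropy d V (state V) A = ln (dimension A) - bias_deficit
    (sqrt ((if {i, j} \<subseteq> A then 3/5 else 0)\<^sup>2 + (if {j, k} \<subseteq> A then 9/20 else 0)\<^sup>2))"
proof -
  define b s :: real where "b = (if {i, j} \<subseteq> A then 3/5 else 0)" and "s = (if {j, k} \<subseteq> A then 9/20 else 0)"
  let ?I = "idx d A"
  have fin: "finite A"
    using assms(1) finite_V by (rule finite_subset)
  have inV: "i \<in> V" "j \<in> V" "k \<in> V"
    using edge_in_V ij jk by auto
  have "dimension V = dimension A * dimension (V - A)"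
    unfolding dimension_def using prod.subset_diff[OF assms(1) finite_V] by (simp add: mult.commute)
  then have "1 / dimension V * dimension (V - A) = 1 / dimension A"
    using dimension_pos[of "V - A"] by simp
  then have pt: "partial_trace d V A (state V) = pauli_sum (1 / dimension A) b s A"
    unfolding state_def b_def s_def using inV assms
    by (subst partial_trace_pauli_sum[OF finite_V]) auto
  obtain K where K: "K \<in> operators ?I" "op_mult ?I K K = op_id ?I"
    and eq: "\<And>p. pauli_sum p b s A = op_comb p (op_id ?I) (p * sqrt (b\<^sup>2 + s\<^sup>2)) K"
    and tr: "sqrt (b\<^sup>2 + s\<^sup>2) \<noteq> 0 \<Longrightarrow> op_trace ?I K = 0"
    by (rule pauli_sum_spectral[OF fin, of b s]) (auto simp: b_def s_def split: if_splits)
  have "sqrt (b\<^sup>2 + s\<^sup>2) < sqrt (1\<^sup>2)"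
    by (rule real_sqrt_less_mono) (auto simp: b_def s_def power2_eq_square)
  then have r: "\<bar>sqrt (b\<^sup>2 + s\<^sup>2)\<bar> < 1"
    by simp
  have "card ?I \<noteq> 0"
    using dimension_pos[of A] by (simp add: card_idx_d[OF fin])
  then have "?I \<noteq> {}"
    by auto
  \<comment> \<open>Membership of \<open>j\<close> also rules out the empty set, for which
    \<open>entropy\<close> has a separate clause.\<close>
  from trace_log_involution[OF finite_idx[OF fin] K tr r this] show ?thesis
    using assms(2) unfolding entropy_def Let_def pt eq b_def[symmetric] s_def[symmetric]
    by (auto simp: card_idx_d[OF fin])
qed

lemma state_not_markov:
  assumes "topological_ordering V E vs" and "l < length vs" and "vs ! l = k"
  shows "\<not> cond_indep d V (state V) {k} (set (take l vs) - pa E k) (pa E k)"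
proof -
  define T where "T = set (take l vs)"
  have sub: "pa E k \<subseteq> T"
    using topological_pa[OF assms(1,2)] assms(3) by (simp add: T_def)
  have j: "j \<in> pa E k"
    using jk by (simp add: pa_def)
  have i: "i \<in> T"
    using take_down_closed[OF assms(1), of j l] sub j ij by (auto simp: T_def pa_def)
  have TV: "T \<subseteq> V"
    using assms(1) set_take_subset[of l vs] by (simp add: T_def topological_ordering_def)
  have k: "k \<notin> T" "k \<in> V"
    using assms by (auto simp: T_def topological_ordering_def in_set_conv_nth nth_eq_iff_index_eq)
  have iC: "i \<notin> pa E k"
    using ik by (simp add: pa_def)
  have fin: "finite T"
    by (simp add: T_def)
  have sets: "{k} \<union> pa E k = insert k (pa E k)" "(T - pa E k) \<union> pa E k = T"
    "{k} \<union> (T - pa E k) \<union> pa E k = insert k T"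
    using sub by auto
  have dims: "dimension (insert k T) = 2 * dimension T" "dimension (insert k (pa E k)) = 2 * dimension (pa E k)"
    using k(1) fin finite_pa[of k] no_edges(4)[of k] by (simp_all add: dimension_def pa_def)
  \<comment> \<open>The weights \<open>12/20\<close>, \<open>9/20\<close> and \<open>15/20\<close>
    form a scaled 3-4-5 triple, which keeps the total bias rational.\<close>
  have root: "sqrt ((3/5)\<^sup>2 + (9/20)\<^sup>2) = 3/4"
    by (rule real_sqrt_unique) (simp_all add: power2_eq_square)
  have S1: "entropy d V (state V) (insert k (pa E k)) = ln (2 * dimension (pa E k)) - bias_deficit (9/20)"
    using entropy_state[of "insert k (pa E k)"] sub TV k j iC distinct_chain dims by auto
  have S2: "entropy d V (state V) T = ln (dimension T) - bias_deficit (3/5)"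
    using entropy_state[of T] sub TV k j i by auto
  have S3: "entropy d V (state V) (pa E k) = ln (dimension (pa E k))"
    using entropy_state[of "pa E k"] sub TV k j iC by auto
  have S4: "entropy d V (state V) (insert k T) = ln (2 * dimension T) - bias_deficit (3/4)"
    using entropy_state[of "insert k T"] sub TV k j i dims root by auto
  \<comment> \<open>Adding \<open>k\<close> doubles both dimensions, so the logarithms of dimensions
    cancel and only the deficits remain.\<close>
  have "cond_mutual_info d V (state V) {k} (T - pa E k) (pa E k) =
      bias_deficit (3/4) - bias_deficit (3/5) - bias_deficit (9/20)"
    unfolding cond_mutual_info_def sets S1 S2 S3 S4
    using dimension_pos[of T] dimension_pos[of "pa E k"] by (simp add: ln_mult_pos)
  then show ?thesis
    using bias_deficit_strict by (simp add: cond_indep_def T_def)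
qed

text \<open>The definition asks for some ordering, but the independence at the position of
  \<open>k\<close> fails in every ordering.\<close>

lemma common_state_not_markov: "\<not> directed_quantum_markov V E d (common_state V E d kernel)"
proof
  assume "directed_quantum_markov V E d (common_state V E d kernel)"
  then obtain vs where vs: "topological_ordering V E vs" and ci: "\<forall>l<length vs.
      cond_indep d V (common_state V E d kernel) {vs ! l} (set (take l vs) - pa E (vs ! l)) (pa E (vs ! l))"
    by (auto simp: directed_quantum_markov_def)
  have "k \<in> set vs"
    using vs edge_in_V[OF jk] by (simp add: topological_ordering_def)
  then obtain l where l: "l < length vs" "vs ! l = k"
    by (auto simp: in_set_conv_nth)
  with ci state_not_markov[OF vs l] show False
    unfolding common_state_kernel[OF vs] by metis
qed

end

text \<open>A transitive relation equals its transitive closure, so the failure already shows on a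
  path of two edges.\<close>

lemma not_transitive_dag_chain:
  assumes "\<not> transitive_dag E"
  obtains i j k where "(i, j) \<in> E" and "(j, k) \<in> E" and "(i, k) \<notin> E"
proof -
  have "\<not> trans E"
    using assms trancl_id[of E] by (auto simp: transitive_dag_def)
  then show ?thesis
    using that by (auto simp: trans_def)
qed

theorem proposition4p7:
  fixes V :: "'v set" and E :: "('v \<times> 'v) set"
  assumes "dag V E" and "\<not> transitive_dag E"
  shows "\<exists>(d :: 'v \<Rightarrow> nat) (Q :: 'v \<Rightarrow> ('v \<Rightarrow> nat) cmatrix).
           (\<forall>v\<in>V. 0 < d v) \<and>
           kernel_family V E d Q \<and>
           order_invariant V E d Q \<and>
           \<not> directed_quantum_markov V E d (common_state V E d Q)"
proof -
  obtain i j k where "(i, j) \<in> E" "(j, k) \<in> E" "(i, k) \<notin> E"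
    using not_transitive_dag_chain[OF assms(2)] by blast
  then interpret induced_chain V E i j k
    using assms(1) by unfold_locales
  show ?thesis
    using kernel_family_kernel order_invariant_kernel common_state_not_markov d_simps(4) by blast
qed

end
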